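(* Let $H$ be an antiferromagnetic model on a finite nonempty set $I$. For every finite simple graph $G$ and every collection of vectors $\boldsymbol\lambda^{(v)}\in(\mathbb{R}_{\ge 0})^I$, $v\in V(G)$, $$\widetilde Z_G(\boldsymbol\lambda^{(v)}:v\in V(G))\ \ge\ \prod_{v\in V(G)} Z_{d_v+1}(\boldsymbol\lambda^{(v)})^{1/(d_v+1)},$$ where $d_v=\deg_G(v)$ for each $v\in V(G)$.
   Context: Let $I$ be a finite nonempty set (of spins). A model on $I$ is a symmetric real matrix $H=(H(\sigma,\tau):\sigma,\tau\in I)$ with nonnegative entries. A symmetric entrywise-nonnegative matrix is antiferromagnetic if it has at most one positive eigenvalue, counted with multiplicity; a model is antiferromagnetic if its matrix is. For a finite simple graph $G$ and fugacity vectors $\boldsymbol\lambda^{(v)}=(\lambda^{(v)}_\sigma:\sigma\in I)\in(\mathbb{R}_{\ge0})^I$, $v\in V(G)$, the vertex-inhomogeneous partition function is $$\widetilde Z_G(\boldsymbol\lambda^{(v)}:v\in V(G))=\sum_{\boldsymbol\sigma\in I^{V(G)}}\ \prod_{uv\in E(G)}H(\sigma_u,\sigma_v)\prod_{v\in V(G)}\lambda^{(v)}_{\sigma_v}.$$ For a single vector $\boldsymbol\lambda$, $Z_G(\boldsymbol\lambda)$ is $\widetilde Z_G$ evaluated with $\boldsymbol\lambda^{(v)}=\boldsymbol\lambda$ for all $v$, and $Z_m=Z_{K_m}$ for $m\ge1$, where $K_m$ is the complete graph on $m$ vertices. *)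

theory Defs
  imports "HOL-Analysis.Analysis" "HOL-Computational_Algebra.Polynomial"
begin

section \<open>Antiferromagnetic models\<close>

text \<open>The spin set is the universe of a finite type; matrices are indexed by it.\<close>

definition model :: "real^'i^'i \<Rightarrow> bool" where
  "model H \<longleftrightarrow> transpose H = H \<and> (\<forall>\<sigma> \<tau>. 0 \<le> H $ \<sigma> $ \<tau>)"

text \<open>The determinant of \<open>X \<cdot> 1 - A\<close>, taken over the polynomial ring.\<close>

definition charpoly :: "real^'i^'i \<Rightarrow> real poly" where
  "charpoly A = det (\<chi> i j. (if i = j then [:0, 1:] else 0) - [:A $ i $ j:])"

lemma poly_det:
  fixes M :: "real poly^'i^'i"
  shows "poly (det M) x = det (\<chi> i j. poly (M $ i $ j) x)"
  by (simp add: det_def poly_sum poly_prod)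

lemma poly_charpoly: "poly (charpoly A) x = det (mat x - A)"
  unfolding charpoly_def poly_det
  by (rule arg_cong[where f = det]) (simp add: vec_eq_iff mat_def)

lemma poly_charpoly_eq_0_iff:
  "poly (charpoly A) x = 0 \<longleftrightarrow> (\<exists>v. v \<noteq> 0 \<and> A *v v = x *\<^sub>R v)"
proof -
  have shift: "(mat x - A) *v v = x *\<^sub>R v - A *v v" for v
  proof -
    have "mat x = x *\<^sub>R (mat 1 :: real^'a^'a)"
      by (simp add: vec_eq_iff mat_def)
    then show ?thesis
      by (simp add: matrix_vector_mult_diff_rdistrib scaleR_matrix_vector_assoc[symmetric])
  qed
  have "poly (charpoly A) x = 0 \<longleftrightarrow> \<not> invertible (mat x - A)"
    by (simp add: poly_charpoly invertible_det_nz)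
  also have "\<dots> \<longleftrightarrow> (\<exists>v. v \<noteq> 0 \<and> (mat x - A) *v v = 0)"
    by (auto simp: invertible_left_inverse matrix_left_invertible_ker)
  finally show ?thesis
    unfolding shift right_minus_eq by metis
qed

lemma charpoly_nonzero: "charpoly A \<noteq> 0"
proof
  assume "charpoly A = 0"
  obtain B where B: "\<And>v. norm (A *v v) \<le> norm v * B"
    using bounded_linear.bounded[OF matrix_vector_mul_bounded_linear] by blast
  obtain v where v: "v \<noteq> 0" "A *v v = (\<bar>B\<bar> + 1) *\<^sub>R v"
    using poly_charpoly_eq_0_iff[of A "\<bar>B\<bar> + 1"] \<open>charpoly A = 0\<close> by auto
  have "norm v * (\<bar>B\<bar> + 1) \<le> norm v * B"
    using B[of v] by (simp add: v(2) mult.commute)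
  with v(1) show False by simp
qed

text \<open>The multiset \<open>proots\<close> contains each eigenvalue as often as its multiplicity as a root of
  the characteristic polynomial.\<close>

definition antiferromagnetic :: "real^'i^'i \<Rightarrow> bool" where
  "antiferromagnetic H \<longleftrightarrow> model H \<and> size {#\<mu> \<in># proots (charpoly H). 0 < \<mu>#} \<le> 1"

section \<open>Graphs and partition functions\<close>

definition simple_graph :: "'v set \<Rightarrow> 'v set set \<Rightarrow> bool" where
  "simple_graph V E \<longleftrightarrow> finite V \<and> (\<forall>e\<in>E. e \<subseteq> V \<and> card e = 2)"

definition graph_degree :: "'v set set \<Rightarrow> 'v \<Rightarrow> nat" where
  "graph_degree E v = card {e \<in> E. v \<in> e}"

definition complete_edges :: "'v set \<Rightarrow> 'v set set" where
  "complete_edges V = {e. e \<subseteq> V \<and> card e = 2}"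

text \<open>An edge is an unordered pair, so the weight is well defined only for symmetric \<open>H\<close>.\<close>

definition edge_weight :: "real^'i^'i \<Rightarrow> ('v \<Rightarrow> 'i) \<Rightarrow> 'v set \<Rightarrow> real" where
  "edge_weight H s e = (THE w. \<exists>u v. e = {u, v} \<and> w = H $ s u $ s v)"

lemma edge_weight_pair:
  assumes "transpose H = H"
  shows "edge_weight H s {u, v} = H $ s u $ s v"
proof -
  have sym: "H $ a $ b = H $ b $ a" for a b
    using assms by (metis transpose_def vec_lambda_beta)
  show ?thesis
    unfolding edge_weight_def by (rule the_equality) (auto simp: doubleton_eq_iff sym)
qed

definition Z_inhom ::
  "real^'i^'i \<Rightarrow> 'v set \<Rightarrow> 'v set set \<Rightarrow> ('v \<Rightarrow> real^'i) \<Rightarrow> real" where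
  "Z_inhom H V E L =
    (\<Sum>s \<in> V \<rightarrow>\<^sub>E UNIV. (\<Prod>e\<in>E. edge_weight H s e) * (\<Prod>v\<in>V. L v $ s v))"

definition Z :: "real^'i^'i \<Rightarrow> 'v set \<Rightarrow> 'v set set \<Rightarrow> real^'i \<Rightarrow> real" where
  "Z H V E l = Z_inhom H V E (\<lambda>_. l)"

definition Z_complete :: "real^'i^'i \<Rightarrow> nat \<Rightarrow> real^'i \<Rightarrow> real" where
  "Z_complete H m l = Z H {..<m} (complete_edges {..<m}) l"

end

theory Submission
  imports Defs
begin

text \<open>Write \<open>Z\<^sub>n\<close> for the partition function of \<open>K\<^sub>n\<close>. Since \<open>H\<close> has at most one positive eigenvalue,
  the Hessian of \<open>Z\<^sub>n\<close> at every point of the orthant has Lorentzian signature, so \<open>Z\<^sub>n\<close> to the power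
  \<open>1/n\<close> lies below its tangent hyperplanes. Call a nonnegative vector \<open>u\<close> supporting of order \<open>n\<close>
  if \<open>Z\<^sub>n(\<lambda>) \<le> \<langle>\<lambda>, u\<rangle>\<^sup>n\<close> on the orthant. By Hoelder's inequality supporting vectors are closed under
  coordinatewise geometric means, and if \<open>y ^ (n - 1)\<close> is supporting of order \<open>n \<ge> 2\<close>
  then \<open>y ^ n\<close> is supporting of order \<open>n + 1\<close>.

  The theorem follows by deleting a vertex \<open>u\<close> of maximal degree \<open>d\<close>. By induction it remains to bound
  below a sum over the spin \<open>\<sigma>\<close> of \<open>u\<close>, weighted by \<open>\<lambda>\<close>, of a product of \<open>d\<close> factors \<open>y\<^sub>w(\<sigma>)\<close>, one per
  neighbour. The normalised factor of a neighbour of degree \<open>k \<le> d\<close> is the \<open>k\<close>-th root of a gradient of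
  \<open>Z\<close> of order \<open>k + 1\<close>; hence its \<open>d\<close>-th power is supporting of order \<open>d + 1\<close>, and so is the
  product of the factors, being the geometric mean of these \<open>d\<close>-th powers.\<close>

section \<open>Lorentzian forms\<close>

definition qf :: "('i::finite \<Rightarrow> 'i \<Rightarrow> real) \<Rightarrow> ('i \<Rightarrow> real) \<Rightarrow> ('i \<Rightarrow> real) \<Rightarrow> real" where
  "qf A x y = (\<Sum>\<sigma>\<in>UNIV. \<Sum>\<tau>\<in>UNIV. x \<sigma> * A \<sigma> \<tau> * y \<tau>)"

text \<open>For symmetric \<open>A\<close> this means at most one positive eigenvalue.
  Non-positivity on a hyperplane passes through congruences without diagonalising;
  \<open>u = 0\<close> covers negative semidefinite forms.\<close>

definition lorentzian :: "('i::finite \<Rightarrow> 'i \<Rightarrow> real) \<Rightarrow> bool" where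
  "lorentzian A \<longleftrightarrow> (\<exists>u. \<forall>x. (\<Sum>\<sigma>\<in>UNIV. u \<sigma> * x \<sigma>) = 0 \<longrightarrow> qf A x x \<le> 0)"

lemma qf_commute:
  assumes "\<And>\<sigma> \<tau>. A \<sigma> \<tau> = A \<tau> \<sigma>"
  shows "qf A x y = qf A y x"
  unfolding qf_def by (subst sum.swap) (simp add: assms[of _ "_"] mult_ac)

lemma qf_diff_scaled:
  assumes "\<And>\<sigma> \<tau>. A \<sigma> \<tau> = A \<tau> \<sigma>"
  shows "qf A (\<lambda>\<sigma>. c * x \<sigma> - d * y \<sigma>) (\<lambda>\<sigma>. c * x \<sigma> - d * y \<sigma>) =
    c\<^sup>2 * qf A x x - 2 * c * d * qf A x y + d\<^sup>2 * qf A y y"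
proof -
  have "qf A (\<lambda>\<sigma>. c * x \<sigma> - d * y \<sigma>) (\<lambda>\<sigma>. c * x \<sigma> - d * y \<sigma>) =
    c\<^sup>2 * qf A x x - c * d * qf A x y - c * d * qf A y x + d\<^sup>2 * qf A y y"
    unfolding qf_def sum_distrib_left sum.distrib[symmetric] sum_subtractf[symmetric]
    by (intro sum.cong refl) (simp add: algebra_simps power2_eq_square)
  then show ?thesis using qf_commute[of A y x, OF assms] by simp
qed

text \<open>The combination \<open>c x - d y\<close> orthogonal to \<open>u\<close> has non-positive square; multiplying by
  \<open>qf A y y\<close> and completing the square gives the reverse Cauchy-Schwarz inequality.\<close>

lemma lorentzian_ineq:
  assumes "lorentzian A" and sym: "\<And>\<sigma> \<tau>. A \<sigma> \<tau> = A \<tau> \<sigma>" and Y: "qf A y y > 0"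
  shows "qf A x x * qf A y y \<le> (qf A x y)\<^sup>2"
proof -
  obtain u where u: "\<And>x. (\<Sum>\<sigma>\<in>UNIV. u \<sigma> * x \<sigma>) = 0 \<Longrightarrow> qf A x x \<le> 0"
    using assms(1) unfolding lorentzian_def by blast
  define c d where "c = (\<Sum>\<sigma>\<in>UNIV. u \<sigma> * y \<sigma>)" and "d = (\<Sum>\<sigma>\<in>UNIV. u \<sigma> * x \<sigma>)"
  have "c \<noteq> 0" using u[of y] Y by (auto simp: c_def)
  have "(\<Sum>\<sigma>\<in>UNIV. u \<sigma> * (c * x \<sigma> - d * y \<sigma>)) = c * d - d * c"
    unfolding c_def d_def sum_distrib_left sum_distrib_right sum_subtractf[symmetric]
    by (simp add: right_diff_distrib sum_subtractf sum_distrib_left sum_distrib_right mult_ac)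
  then have "qf A (\<lambda>\<sigma>. c * x \<sigma> - d * y \<sigma>) (\<lambda>\<sigma>. c * x \<sigma> - d * y \<sigma>) \<le> 0"
    by (intro u) simp
  then have "c\<^sup>2 * qf A x x - 2 * c * d * qf A x y + d\<^sup>2 * qf A y y \<le> 0"
    by (simp add: qf_diff_scaled[OF sym])
  then have "(c\<^sup>2 * qf A x x - 2 * c * d * qf A x y + d\<^sup>2 * qf A y y) * qf A y y \<le> 0"
    using Y by (simp add: mult_nonpos_nonneg)
  moreover have "(c\<^sup>2 * qf A x x - 2 * c * d * qf A x y + d\<^sup>2 * qf A y y) * qf A y y
    = (d * qf A y y - c * qf A x y)\<^sup>2 + c\<^sup>2 * (qf A x x * qf A y y - (qf A x y)\<^sup>2)"
    by (simp add: algebra_simps power2_eq_square)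
  ultimately have "c\<^sup>2 * (qf A x x * qf A y y - (qf A x y)\<^sup>2) \<le> 0"
    by (smt (verit) zero_le_power2)
  then show ?thesis using \<open>c \<noteq> 0\<close> by (simp add: mult_le_0_iff)
qed

lemma qf_sum_left: "qf A (\<lambda>\<sigma>. \<Sum>\<rho>\<in>I. x \<rho> * S \<rho> \<sigma>) y = (\<Sum>\<rho>\<in>I. x \<rho> * qf A (S \<rho>) y)"
proof -
  have "qf A (\<lambda>\<sigma>. \<Sum>\<rho>\<in>I. x \<rho> * S \<rho> \<sigma>) y
    = (\<Sum>\<sigma>\<in>UNIV. \<Sum>\<rho>\<in>I. x \<rho> * (\<Sum>\<tau>\<in>UNIV. S \<rho> \<sigma> * A \<sigma> \<tau> * y \<tau>))"
    unfolding qf_def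
  proof (rule sum.cong[OF refl])
    fix \<sigma>
    have "(\<Sum>\<tau>\<in>UNIV. (\<Sum>\<rho>\<in>I. x \<rho> * S \<rho> \<sigma>) * A \<sigma> \<tau> * y \<tau>)
      = (\<Sum>\<tau>\<in>UNIV. \<Sum>\<rho>\<in>I. x \<rho> * (S \<rho> \<sigma> * A \<sigma> \<tau> * y \<tau>))"
      by (simp only: sum_distrib_right mult.assoc)
    then show "(\<Sum>\<tau>\<in>UNIV. (\<Sum>\<rho>\<in>I. x \<rho> * S \<rho> \<sigma>) * A \<sigma> \<tau> * y \<tau>)
      = (\<Sum>\<rho>\<in>I. x \<rho> * (\<Sum>\<tau>\<in>UNIV. S \<rho> \<sigma> * A \<sigma> \<tau> * y \<tau>))"
      by (subst (asm) sum.swap) (simp only: sum_distrib_left)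
  qed
  then show ?thesis
    by (subst (asm) sum.swap) (simp only: sum_distrib_left[symmetric] qf_def)
qed

lemma qf_sum_right: "qf A x (\<lambda>\<sigma>. \<Sum>\<rho>\<in>I. y \<rho> * S \<rho> \<sigma>) = (\<Sum>\<rho>\<in>I. y \<rho> * qf A x (S \<rho>))"
proof -
  have flip: "qf A u v = qf (\<lambda>\<sigma> \<tau>. A \<tau> \<sigma>) v u" for u v :: "'a \<Rightarrow> real"
    unfolding qf_def by (subst sum.swap) (simp only: mult_ac)
  show ?thesis unfolding flip[of x] by (rule qf_sum_left)
qed

text \<open>The new form is the pullback of \<open>A\<close> along the linear map sending the unit
  vector at \<open>\<rho>\<close> to \<open>S \<rho>\<close>; the normal \<open>u\<close> of the
  hyperplane is pulled back along the same map.\<close>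

lemma lorentzian_congruence:
  assumes "lorentzian A"
  shows "lorentzian (\<lambda>\<sigma> \<tau>. qf A (S \<sigma>) (S \<tau>))"
proof -
  obtain u where u: "\<And>x. (\<Sum>\<sigma>\<in>UNIV. u \<sigma> * x \<sigma>) = 0 \<Longrightarrow> qf A x x \<le> 0"
    using assms unfolding lorentzian_def by blast
  show ?thesis
    unfolding lorentzian_def
  proof (rule exI[of _ "\<lambda>\<rho>. \<Sum>\<sigma>\<in>UNIV. u \<sigma> * S \<rho> \<sigma>"], intro allI impI)
    fix x assume x: "(\<Sum>\<rho>\<in>UNIV. (\<Sum>\<sigma>\<in>UNIV. u \<sigma> * S \<rho> \<sigma>) * x \<rho>) = 0"
    define z where "z \<sigma> = (\<Sum>\<rho>\<in>UNIV. x \<rho> * S \<rho> \<sigma>)" for \<sigma>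
    have "(\<Sum>\<sigma>\<in>UNIV. u \<sigma> * z \<sigma>) = 0"
      unfolding z_def sum_distrib_left
      by (subst sum.swap) (use x in \<open>simp add: sum_distrib_left sum_distrib_right mult_ac\<close>)
    then have "qf A z z \<le> 0" by (rule u)
    also have "qf A z z = qf (\<lambda>\<sigma> \<tau>. qf A (S \<sigma>) (S \<tau>)) x x"
      unfolding z_def qf_sum_left qf_sum_right unfolding qf_def[of "\<lambda>\<sigma> \<tau>. qf A (S \<sigma>) (S \<tau>)"]
      by (simp add: sum_distrib_left mult_ac)
    finally show "qf (\<lambda>\<sigma> \<tau>. qf A (S \<sigma>) (S \<tau>)) x x \<le> 0" .
  qed
qed

lemma qf_delta:
  "qf A (\<lambda>\<rho>. if \<rho> = \<sigma> then c else 0) (\<lambda>\<rho>. if \<rho> = \<tau> then d else 0) = c * d * A \<sigma> \<tau>"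
proof -
  have "(if \<rho> = \<sigma> then c else 0) * A \<rho> \<rho>' * (if \<rho>' = \<tau> then d else 0) =
     (if \<rho>' = \<tau> then (if \<rho> = \<sigma> then c * d * A \<sigma> \<tau> else 0) else 0)" for \<rho> \<rho>' by simp
  then show ?thesis unfolding qf_def by (simp add: sum.delta)
qed

lemma lorentzian_diagonal:
  assumes "lorentzian A"
  shows "lorentzian (\<lambda>\<sigma> \<tau>. d \<sigma> * d \<tau> * A \<sigma> \<tau>)"
  using lorentzian_congruence[OF assms, of "\<lambda>\<sigma> \<rho>. if \<rho> = \<sigma> then d \<sigma> else 0"]
  by (simp add: qf_delta)

section \<open>Symmetric matrices: from eigenvalue multiplicities to the Lorentzian property\<close>

lemma symmetric_inner:
  fixes M :: "real^'n^'n"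
  assumes "transpose M = M"
  shows "x \<bullet> (M *v y) = y \<bullet> (M *v x)"
  by (metis assms dot_lmul_matrix inner_commute vector_transpose_matrix)

text \<open>By compactness the Rayleigh quotient attains its maximum on the unit sphere of
  \<open>S\<close>. Moving the maximiser along its residual \<open>r\<close>, which stays in
  \<open>S\<close> by invariance, shows that \<open>r\<close> vanishes.\<close>

lemma symmetric_eigenvector:
  fixes M :: "real^'n^'n"
  assumes sym: "transpose M = M" and S: "subspace S" "S \<noteq> {0}"
    and inv: "\<And>x. x \<in> S \<Longrightarrow> M *v x \<in> S"
  obtains v \<theta> where "v \<in> S" "norm v = 1" "M *v v = \<theta> *\<^sub>R v" "\<And>x. x \<in> S \<Longrightarrow> x \<bullet> (M *v x) \<le> \<theta> * (x \<bullet> x)"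
proof -
  have comp: "compact (S \<inter> sphere 0 1)"
    using S(1) by (simp add: closed_subspace closed_Int_compact)
  obtain z where "z \<in> S" "z \<noteq> 0" using S subspace_0 by blast
  then have "z /\<^sub>R norm z \<in> S \<inter> sphere 0 1" using S(1) by (simp add: subspace_scale)
  then have ne: "S \<inter> sphere 0 1 \<noteq> {}" by blast
  have "continuous_on (S \<inter> sphere 0 1) (\<lambda>x. x \<bullet> (M *v x))"
    by (intro continuous_intros matrix_vector_mult_linear_continuous_on)
  from continuous_attains_sup[OF comp ne this] obtain v
    where v: "v \<in> S" "norm v = 1" and max: "\<And>x. x \<in> S \<Longrightarrow> norm x = 1 \<Longrightarrow> x \<bullet> (M *v x) \<le> v \<bullet> (M *v v)"
    by auto
  define \<theta> where "\<theta> = v \<bullet> (M *v v)"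
  have bound: "x \<bullet> (M *v x) \<le> \<theta> * (x \<bullet> x)" if "x \<in> S" for x
  proof (cases "x = 0")
    case False
    have "(x /\<^sub>R norm x) \<bullet> (M *v (x /\<^sub>R norm x)) \<le> \<theta>"
      unfolding \<theta>_def using that False S(1) by (intro max) (auto simp: subspace_scale)
    then have "x \<bullet> (M *v x) / (norm x)\<^sup>2 \<le> \<theta>"
      by (simp add: matrix_vector_mult_scaleR divide_inverse power2_eq_square mult_ac)
    then show ?thesis using False by (simp add: divide_le_eq power2_norm_eq_inner)
  qed simp
  define r where "r = M *v v - \<theta> *\<^sub>R v"
  have rS: "r \<in> S" unfolding r_def using S(1) v inv by (simp add: subspace_diff subspace_scale)
  define b where "b = r \<bullet> (M *v r) - \<theta> * (r \<bullet> r)"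
  have key: "2 * t * (r \<bullet> r) + t\<^sup>2 * b \<le> 0" for t
  proof -
    have "(v + t *\<^sub>R r) \<bullet> (M *v (v + t *\<^sub>R r)) \<le> \<theta> * ((v + t *\<^sub>R r) \<bullet> (v + t *\<^sub>R r))"
      by (rule bound) (use S(1) v rS in \<open>simp add: subspace_add subspace_scale\<close>)
    moreover have "v \<bullet> v = 1" using v(2) by (simp add: norm_eq_1)
    moreover have "v \<bullet> (M *v r) = r \<bullet> r + \<theta> * (r \<bullet> v)"
      by (subst symmetric_inner[OF sym]) (simp add: r_def inner_diff_right algebra_simps)
    moreover have "r \<bullet> (M *v v) = r \<bullet> r + \<theta> * (r \<bullet> v)"
      by (simp add: r_def inner_diff_right algebra_simps)
    ultimately show ?thesis
      by (simp add: matrix_vector_right_distrib matrix_vector_mult_scaleR inner_add_left inner_add_right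
          b_def \<theta>_def[symmetric] algebra_simps power2_eq_square inner_commute)
  qed
  have "r \<bullet> r \<le> 0"
  proof (rule ccontr)
    assume "\<not> r \<bullet> r \<le> 0"
    then have pos: "r \<bullet> r > 0" by linarith
    \<comment> \<open>Small enough that \<open>t * b\<close> cannot outweigh
      \<open>2 * (r \<bullet> r)\<close> in \<open>key\<close>.\<close>
    define t where "t = (r \<bullet> r) / (\<bar>b\<bar> + 1)"
    have t: "t > 0" using pos by (simp add: t_def)
    have "t * (2 * (r \<bullet> r) + t * b) \<le> 0" using key[of t] by (simp add: algebra_simps power2_eq_square)
    then have "2 * (r \<bullet> r) + t * b \<le> 0" using t by (simp add: mult_le_0_iff)
    moreover have "\<bar>t * b\<bar> \<le> r \<bullet> r" using pos unfolding t_def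
      by (simp add: abs_mult divide_le_eq mult_left_mono)
    ultimately show False using pos by linarith
  qed
  then have "r = 0" by (metis inner_ge_zero inner_eq_zero_iff order_antisym)
  then have "M *v v = \<theta> *\<^sub>R v" by (simp add: r_def)
  with v bound that show ?thesis by blast
qed

text \<open>In a basis through \<open>v1\<close> and \<open>v2\<close>, two rows of the
  characteristic matrix are linear factors times constant rows. Independence of the eigenvectors is
  the hypothesis, so \<open>\<theta>1 = \<theta>2\<close> gives a double root.\<close>

lemma linear_factors_dvd_charpoly:
  fixes M :: "real^'n^'n"
  assumes eig: "M *v v1 = \<theta>1 *\<^sub>R v1" "M *v v2 = \<theta>2 *\<^sub>R v2"
    and ind: "independent {v1, v2}" "v1 \<noteq> v2"
  shows "[:-\<theta>1, 1:] * [:-\<theta>2, 1:] dvd charpoly M"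
proof -
  obtain B where B: "{v1, v2} \<subseteq> B" "independent B" "UNIV \<subseteq> span B"
    by (rule maximal_independent_subset_extend[OF subset_UNIV ind(1)])
  have "finite B" using B(2) by (rule independent_imp_finite)
  have "card B = DIM(real^'n)"
    using basis_card_eq_dim[of B UNIV] B by simp
  then have "card B = CARD('n)" by simp
  then obtain h :: "'n \<Rightarrow> real^'n" where h: "bij_betw h UNIV B"
    using finite_same_card_bij[of "UNIV :: 'n set" B] \<open>finite B\<close> by auto
  obtain i j where ij: "h i = v1" "h j = v2"
  proof -
    have "v1 \<in> range h" "v2 \<in> range h"
      using h B(1) by (simp_all add: bij_betw_imp_surj_on)
    then show thesis using that by (elim rangeE) simp
  qed
  have "i \<noteq> j" using ij ind(2) by auto
  define S :: "real^'n^'n" where "S = (\<chi> k. h k)"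
  have "rows S = range h"
    unfolding rows_def row_def S_def by auto
  then have rows: "rows S = B"
    using h by (simp add: bij_betw_def)
  then have "span (rows S) = UNIV" using B(3) by auto
  then have "invertible S"
    by (simp add: matrix_left_invertible_span_rows invertible_left_inverse)
  then have detS: "det S \<noteq> 0" by (simp add: invertible_det_nz)
  \<comment> \<open>The rows of \<open>S ** transpose (mat x - M)\<close> as polynomials in
    \<open>x\<close>, after removing \<open>x - \<theta>1\<close> and \<open>x - \<theta>2\<close>
    from the two eigenvector rows.\<close>
  define N :: "real poly^'n^'n" where
    "N = (\<chi> k l. if k = i \<or> k = j then [:h k $ l:] else [:- (M *v h k) $ l, h k $ l:])"
  define c where "c x k = (if k = i then x - \<theta>1 else if k = j then x - \<theta>2 else 1)" for x k
  have eigh: "M *v h i = \<theta>1 *\<^sub>R h i" "M *v h j = \<theta>2 *\<^sub>R h j" using ij eig by auto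
  have key: "det S * poly (charpoly M) x = (x - \<theta>1) * (x - \<theta>2) * poly (det N) x" for x
  proof -
    have mx: "mat x *v y = x *\<^sub>R y" for y :: "real^'n"
      by (simp add: matrix_vector_mult_def mat_def vec_eq_iff if_distrib if_distribR cong: if_cong)
    have "S ** transpose (mat x - M) = (\<chi> k. c x k *s (\<chi> l. poly (N $ k $ l) x))"
    proof (intro iffD2[OF vec_eq_iff] allI)
      fix k l
      have "(S ** transpose (mat x - M)) $ k $ l = ((mat x - M) *v h k) $ l"
        by (simp add: matrix_matrix_mult_def matrix_vector_mult_def transpose_def S_def mult.commute)
      also have "\<dots> = x * h k $ l - (M *v h k) $ l"
        by (simp add: matrix_vector_mult_diff_rdistrib mx)
      also have "\<dots> = (\<chi> k. c x k *s (\<chi> l. poly (N $ k $ l) x)) $ k $ l"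
        using \<open>i \<noteq> j\<close> by (auto simp: c_def N_def eigh algebra_simps)
      finally show "(S ** transpose (mat x - M)) $ k $ l = (\<chi> k. c x k *s (\<chi> l. poly (N $ k $ l) x)) $ k $ l" .
    qed
    then have "det S * det (mat x - M) = det (\<chi> k. c x k *s (\<chi> l. poly (N $ k $ l) x))"
      using det_mul[of S "transpose (mat x - M)"] by simp
    also have "\<dots> = prod (c x) UNIV * det (\<chi> k l. poly (N $ k $ l) x)"
      by (rule det_rows_mul)
    also have "prod (c x) UNIV = prod (c x) {i, j}"
      by (rule prod.mono_neutral_right) (auto simp: c_def)
    also have "\<dots> = (x - \<theta>1) * (x - \<theta>2)" using \<open>i \<noteq> j\<close> by (simp add: c_def)
    finally show ?thesis by (simp add: poly_charpoly poly_det)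
  qed
  have "smult (det S) (charpoly M) = [:-\<theta>1, 1:] * [:-\<theta>2, 1:] * det N"
    using key by (intro poly_ext) (simp add: algebra_simps)
  then show ?thesis
    using detS dvd_smult_iff[of "det S" "[:-\<theta>1, 1:] * [:-\<theta>2, 1:]" "charpoly M"]
    by (metis dvd_triv_left)
qed

text \<open>The hyperplane is the orthogonal complement of a top eigenvector \<open>v1\<close>. A
  positive value there would yield a second eigenvector with \<open>0 < \<theta>2\<close> and
  \<open>\<theta>2 \<le> \<theta>1\<close>, hence two positive roots counted with
  multiplicity.\<close>

lemma antiferromagnetic_lorentzian:
  fixes H :: "real^'i^'i"
  assumes "antiferromagnetic H"
  shows "lorentzian (\<lambda>\<sigma> \<tau>. H $ \<sigma> $ \<tau>)"
proof -
  have sym: "transpose H = H" and few: "size {#\<mu> \<in># proots (charpoly H). 0 < \<mu>#} \<le> 1"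
    using assms by (auto simp: antiferromagnetic_def model_def)
  have qf: "qf (\<lambda>\<sigma> \<tau>. H $ \<sigma> $ \<tau>) x x = (\<chi> \<sigma>. x \<sigma>) \<bullet> (H *v (\<chi> \<sigma>. x \<sigma>))" for x
    by (simp add: qf_def inner_vec_def matrix_vector_mult_def sum_distrib_left mult_ac)
  have "axis undefined 1 \<noteq> (0 :: real^'i)" by simp
  then have "(UNIV :: (real^'i) set) \<noteq> {0}" by blast
  then obtain v1 \<theta>1 where v1: "norm v1 = 1" "H *v v1 = \<theta>1 *\<^sub>R v1"
    and b1: "\<And>x. x \<bullet> (H *v x) \<le> \<theta>1 * (x \<bullet> x)"
    using symmetric_eigenvector[OF sym subspace_UNIV] by (metis UNIV_I)
  define S where "S = {x. v1 \<bullet> x = 0}"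
  have S: "subspace S" unfolding S_def by (rule subspace_hyperplane)
  have inv: "H *v x \<in> S" if "x \<in> S" for x
    using that symmetric_inner[OF sym, of v1 x] by (simp add: S_def v1 inner_commute)
  have "x \<bullet> (H *v x) \<le> 0" if "x \<in> S" for x
  proof (cases "S = {0}")
    case False
    obtain v2 \<theta>2 where v2: "v2 \<in> S" "norm v2 = 1" "H *v v2 = \<theta>2 *\<^sub>R v2"
      and b2: "\<And>x. x \<in> S \<Longrightarrow> x \<bullet> (H *v x) \<le> \<theta>2 * (x \<bullet> x)"
      using symmetric_eigenvector[OF sym S False inv] by metis
    have "\<theta>2 \<le> 0"
    proof (rule ccontr)
      assume "\<not> \<theta>2 \<le> 0"
      have "\<theta>2 \<le> \<theta>1" using b1[of v2] v2 by (simp add: norm_eq_1)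
      have "v1 \<noteq> 0" "v2 \<noteq> 0" using v1 v2 by auto
      have "v1 \<noteq> v2" using v1 v2 by (auto simp: S_def norm_eq_1)
      have "pairwise orthogonal {v1, v2}"
        using v2(1) by (auto simp: S_def pairwise_insert orthogonal_def inner_commute)
      then have "independent {v1, v2}"
        using \<open>v1 \<noteq> 0\<close> \<open>v2 \<noteq> 0\<close> by (intro pairwise_orthogonal_independent) auto
      then have "[:-\<theta>1, 1:] * [:-\<theta>2, 1:] dvd charpoly H"
        using \<open>v1 \<noteq> v2\<close> v1 v2 by (intro linear_factors_dvd_charpoly)
      then obtain q where q: "charpoly H = [:-\<theta>1, 1:] * [:-\<theta>2, 1:] * q" by (rule dvdE)
      moreover have "q \<noteq> 0" using q charpoly_nonzero[of H] by auto
      ultimately have "proots (charpoly H) = {#\<theta>1, \<theta>2#} + proots q"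
        by (simp add: proots_mult del: mult_pCons_left mult_pCons_right)
      then have "2 \<le> size {#\<mu> \<in># proots (charpoly H). 0 < \<mu>#}"
        using \<open>\<not> \<theta>2 \<le> 0\<close> \<open>\<theta>2 \<le> \<theta>1\<close> by simp
      with few show False by simp
    qed
    then show ?thesis using b2[OF that] by (smt (verit) inner_ge_zero mult_nonpos_nonneg)
  qed (use that in auto)
  then show ?thesis
    unfolding lorentzian_def qf
  proof (intro exI[of _ "\<lambda>\<sigma>. v1 $ \<sigma>"] allI impI)
    fix x :: "'i \<Rightarrow> real"
    assume "(\<Sum>\<sigma>\<in>UNIV. v1 $ \<sigma> * x \<sigma>) = 0"
    then have "(\<chi> \<sigma>. x \<sigma>) \<in> S" by (simp add: S_def inner_vec_def)
    then show "(\<chi> \<sigma>. x \<sigma>) \<bullet> (H *v (\<chi> \<sigma>. x \<sigma>)) \<le> 0"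
      by (rule \<open>\<And>x. x \<in> S \<Longrightarrow> x \<bullet> (H *v x) \<le> 0\<close>)
  qed
qed

text \<open>Ground-state substitution: in the variable \<open>x / c\<close>, the gap between a
  diagonal form and \<open>A\<close> is a Dirichlet form. For positive \<open>A\<close> it vanishes
  only when \<open>x\<close> is proportional to \<open>c\<close>, which settles the equality case in
  \<open>lorentzian_step\<close>.\<close>

lemma rayleigh_gap:
  fixes A :: "'i::finite \<Rightarrow> 'i \<Rightarrow> real"
  assumes sym: "\<And>\<sigma> \<tau>. A \<sigma> \<tau> = A \<tau> \<sigma>" and c: "\<And>\<sigma>. c \<sigma> > 0"
  shows "(\<Sum>\<sigma>\<in>UNIV. \<Sum>\<tau>\<in>UNIV. A \<sigma> \<tau> * c \<sigma> * c \<tau> * (x \<sigma> / c \<sigma> - x \<tau> / c \<tau>)\<^sup>2)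
    = 2 * ((\<Sum>\<sigma>\<in>UNIV. (\<Sum>\<tau>\<in>UNIV. A \<sigma> \<tau> * c \<tau>) / c \<sigma> * (x \<sigma>)\<^sup>2) - qf A x x)"
proof -
  define w where "w \<sigma> = (\<Sum>\<tau>\<in>UNIV. A \<sigma> \<tau> * c \<tau>)" for \<sigma>
  define T where "T \<sigma> \<tau> = A \<sigma> \<tau> * c \<tau> / c \<sigma> * (x \<sigma>)\<^sup>2" for \<sigma> \<tau>
  have "A \<sigma> \<tau> * c \<sigma> * c \<tau> * (x \<sigma> / c \<sigma> - x \<tau> / c \<tau>)\<^sup>2
      = T \<sigma> \<tau> + T \<tau> \<sigma> - 2 * (x \<sigma> * A \<sigma> \<tau> * x \<tau>)" for \<sigma> \<tau>
    using c[of \<sigma>] c[of \<tau>] unfolding T_def sym[of \<tau> \<sigma>]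
    by (simp add: field_simps power2_eq_square)
  then have "(\<Sum>\<sigma>\<in>UNIV. \<Sum>\<tau>\<in>UNIV. A \<sigma> \<tau> * c \<sigma> * c \<tau> * (x \<sigma> / c \<sigma> - x \<tau> / c \<tau>)\<^sup>2)
    = (\<Sum>\<sigma>\<in>UNIV. \<Sum>\<tau>\<in>UNIV. T \<sigma> \<tau>) + (\<Sum>\<sigma>\<in>UNIV. \<Sum>\<tau>\<in>UNIV. T \<tau> \<sigma>) - 2 * qf A x x"
    by (simp add: sum.distrib sum_subtractf qf_def sum_distrib_left)
  also have "(\<Sum>\<sigma>\<in>UNIV. \<Sum>\<tau>\<in>UNIV. T \<tau> \<sigma>) = (\<Sum>\<sigma>\<in>UNIV. \<Sum>\<tau>\<in>UNIV. T \<sigma> \<tau>)"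
    by (rule sum.swap)
  also have "(\<Sum>\<sigma>\<in>UNIV. \<Sum>\<tau>\<in>UNIV. T \<sigma> \<tau>) = (\<Sum>\<sigma>\<in>UNIV. w \<sigma> / c \<sigma> * (x \<sigma>)\<^sup>2)"
    by (simp add: T_def w_def sum_distrib_right sum_divide_distrib)
  finally show ?thesis by (simp add: w_def)
qed

text \<open>The Bochner step: adding up the reverse Cauchy-Schwarz inequalities of the \<open>B \<rho>\<close> gives
  \<open>M \<le> M\<^sup>2\<close> for the normalisation \<open>M\<close> of \<open>A\<close> whose Perron eigenvalue is \<open>1\<close>. So a positive
  eigenvalue of \<open>M\<close> is at least, hence equal to, \<open>1\<close>, and that eigenvalue is simple.\<close>

lemma lorentzian_step:
  fixes A :: "'i::finite \<Rightarrow> 'i \<Rightarrow> real"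
  assumes sym: "\<And>\<sigma> \<tau>. A \<sigma> \<tau> = A \<tau> \<sigma>" and pos: "\<And>\<sigma> \<tau>. A \<sigma> \<tau> > 0"
    and c: "\<And>\<sigma>. c \<sigma> > 0"
    and A: "\<And>\<sigma> \<tau>. A \<sigma> \<tau> = (\<Sum>\<rho>\<in>UNIV. c \<rho> * B \<rho> \<sigma> \<tau>)"
    and Bc: "\<And>\<rho> \<sigma>. (\<Sum>\<tau>\<in>UNIV. B \<rho> \<sigma> \<tau> * c \<tau>) = A \<rho> \<sigma>"
    and B: "\<And>\<rho>. lorentzian (B \<rho>)" and Bsym: "\<And>\<rho> \<sigma> \<tau>. B \<rho> \<sigma> \<tau> = B \<rho> \<tau> \<sigma>"
  shows "lorentzian A"
proof -
  define w where "w \<sigma> = (\<Sum>\<tau>\<in>UNIV. A \<sigma> \<tau> * c \<tau>)" for \<sigma>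
  have w: "w \<sigma> > 0" for \<sigma>
    unfolding w_def by (intro sum_pos mult_pos_pos pos c) auto
  \<comment> \<open>Reverse Cauchy-Schwarz for each \<open>B \<rho>\<close> against
    \<open>c\<close>: by \<open>Bc\<close>, pairing \<open>x\<close> with \<open>c\<close> gives the
    entry of \<open>A x\<close> at \<open>\<rho>\<close>, and \<open>c\<close> with itself gives
    \<open>w \<rho>\<close>.\<close>
  have bound: "qf A x x \<le> (\<Sum>\<rho>\<in>UNIV. c \<rho> / w \<rho> * (\<Sum>\<sigma>\<in>UNIV. A \<rho> \<sigma> * x \<sigma>)\<^sup>2)" for x
  proof -
    have each: "c \<rho> * qf (B \<rho>) x x \<le> c \<rho> / w \<rho> * (\<Sum>\<sigma>\<in>UNIV. A \<rho> \<sigma> * x \<sigma>)\<^sup>2" for \<rho>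
    proof -
      have xc: "qf (B \<rho>) y c = (\<Sum>\<sigma>\<in>UNIV. A \<rho> \<sigma> * y \<sigma>)" for y
        unfolding qf_def Bc[symmetric] by (simp add: sum_distrib_left sum_distrib_right mult_ac)
      have "qf (B \<rho>) c c = w \<rho>" by (simp add: xc w_def)
      then have "qf (B \<rho>) x x * w \<rho> \<le> (\<Sum>\<sigma>\<in>UNIV. A \<rho> \<sigma> * x \<sigma>)\<^sup>2"
        using lorentzian_ineq[OF B Bsym, of \<rho> c x] w[of \<rho>] by (simp add: xc)
      then have "qf (B \<rho>) x x \<le> (\<Sum>\<sigma>\<in>UNIV. A \<rho> \<sigma> * x \<sigma>)\<^sup>2 / w \<rho>"
        using w[of \<rho>] by (simp add: pos_le_divide_eq)
      then show ?thesis using c[of \<rho>] by (simp add: mult_left_mono flip: times_divide_eq_right)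
    qed
    have "qf A x x = (\<Sum>\<sigma>\<in>UNIV. \<Sum>\<tau>\<in>UNIV. \<Sum>\<rho>\<in>UNIV. c \<rho> * (x \<sigma> * B \<rho> \<sigma> \<tau> * x \<tau>))"
      unfolding qf_def A by (simp add: sum_distrib_left sum_distrib_right mult_ac)
    also have "\<dots> = (\<Sum>\<sigma>\<in>UNIV. \<Sum>\<rho>\<in>UNIV. \<Sum>\<tau>\<in>UNIV. c \<rho> * (x \<sigma> * B \<rho> \<sigma> \<tau> * x \<tau>))"
      by (intro sum.cong refl sum.swap)
    also have "\<dots> = (\<Sum>\<rho>\<in>UNIV. \<Sum>\<sigma>\<in>UNIV. \<Sum>\<tau>\<in>UNIV. c \<rho> * (x \<sigma> * B \<rho> \<sigma> \<tau> * x \<tau>))"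
      by (rule sum.swap)
    also have "\<dots> = (\<Sum>\<rho>\<in>UNIV. c \<rho> * qf (B \<rho>) x x)"
      by (simp only: qf_def sum_distrib_left)
    also have "\<dots> \<le> (\<Sum>\<rho>\<in>UNIV. c \<rho> / w \<rho> * (\<Sum>\<sigma>\<in>UNIV. A \<rho> \<sigma> * x \<sigma>)\<^sup>2)"
      by (intro sum_mono each)
    finally show ?thesis .
  qed
  \<comment> \<open>The weights make \<open>M\<close> symmetric while \<open>v0\<close>, which is
    both \<open>c / g\<close> and \<open>g w\<close>, becomes an eigenvector for the eigenvalue
    1.\<close>
  define g where "g \<sigma> = sqrt (c \<sigma> / w \<sigma>)" for \<sigma>
  have g: "g \<sigma> > 0" "g \<sigma> * g \<sigma> = c \<sigma> / w \<sigma>" for \<sigma>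
    using c[of \<sigma>] w[of \<sigma>] by (simp_all add: g_def less_imp_le)
  define M :: "real^'i^'i" where "M = (\<chi> \<sigma> \<tau>. g \<sigma> * A \<sigma> \<tau> * g \<tau>)"
  define v0 :: "real^'i" where "v0 = (\<chi> \<sigma>. c \<sigma> / g \<sigma>)"
  have v0_alt: "v0 $ \<sigma> = g \<sigma> * w \<sigma>" for \<sigma>
    using g[of \<sigma>] w[of \<sigma>] by (simp add: v0_def field_simps)
  have Msym: "transpose M = M"
    by (simp add: M_def transpose_def vec_eq_iff sym mult_ac)
  have Mx: "(M *v x) $ \<sigma> = g \<sigma> * (\<Sum>\<tau>\<in>UNIV. A \<sigma> \<tau> * (g \<tau> * x $ \<tau>))" for x \<sigma>
    by (simp add: M_def matrix_vector_mult_def sum_distrib_left mult_ac)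
  have Mv0: "M *v v0 = v0"
  proof (intro iffD2[OF vec_eq_iff] allI)
    fix \<sigma>
    have "(M *v v0) $ \<sigma> = g \<sigma> * (\<Sum>\<tau>\<in>UNIV. A \<sigma> \<tau> * c \<tau>)"
      unfolding Mx using g(1) by (simp add: v0_def less_imp_neq[THEN not_sym])
    then show "(M *v v0) $ \<sigma> = v0 $ \<sigma>" by (simp add: v0_alt w_def)
  qed
  have qfM: "qf A (\<lambda>\<sigma>. g \<sigma> * x $ \<sigma>) (\<lambda>\<sigma>. g \<sigma> * x $ \<sigma>) = x \<bullet> (M *v x)" for x
    by (simp add: qf_def inner_vec_def Mx sum_distrib_left mult_ac)
  define S where "S = {x. v0 \<bullet> x = 0}"
  have S: "subspace S" unfolding S_def by (rule subspace_hyperplane)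
  have inv: "M *v x \<in> S" if "x \<in> S" for x
    using that symmetric_inner[OF Msym, of v0 x] by (simp add: S_def Mv0 inner_commute)
  have main: "x \<bullet> (M *v x) \<le> 0" if "x \<in> S" for x
  proof (cases "S = {0}")
    case False
    obtain v \<theta> where v: "v \<in> S" "norm v = 1" "M *v v = \<theta> *\<^sub>R v"
      and b: "\<And>x. x \<in> S \<Longrightarrow> x \<bullet> (M *v x) \<le> \<theta> * (x \<bullet> x)"
      using symmetric_eigenvector[OF Msym S False inv] by metis
    have vv: "v \<bullet> v = 1" using v(2) by (simp add: norm_eq_1)
    have "\<theta> \<le> 0"
    proof (rule ccontr)
      assume "\<not> \<theta> \<le> 0"
      define y where "y \<sigma> = g \<sigma> * v $ \<sigma>" for \<sigma>
      have qy: "qf A y y = \<theta>" unfolding y_def qfM by (simp add: v(3) vv)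
      have Ay: "g \<rho> * (\<Sum>\<sigma>\<in>UNIV. A \<rho> \<sigma> * y \<sigma>) = \<theta> * v $ \<rho>" for \<rho>
        using arg_cong[OF v(3), of "\<lambda>z. z $ \<rho>"] by (simp add: Mx y_def)
      \<comment> \<open>In the coordinates of \<open>M\<close>, \<open>bound\<close> compares
        \<open>M\<close> with its square, so the positive eigenvalue \<open>\<theta>\<close> is at
        least 1.\<close>
      have "\<theta> \<le> (\<Sum>\<rho>\<in>UNIV. c \<rho> / w \<rho> * (\<Sum>\<sigma>\<in>UNIV. A \<rho> \<sigma> * y \<sigma>)\<^sup>2)"
        using bound[of y] by (simp add: qy)
      also have "\<dots> = (\<Sum>\<rho>\<in>UNIV. (\<theta> * v $ \<rho>)\<^sup>2)"
        unfolding Ay[symmetric] power_mult_distrib by (simp add: power2_eq_square g(2))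
      also have "\<dots> = \<theta>\<^sup>2 * (v \<bullet> v)"
        by (simp add: inner_vec_def sum_distrib_left power2_eq_square mult_ac)
      finally have "\<theta> * 1 \<le> \<theta> * \<theta>" by (simp add: vv power2_eq_square)
      then have "1 \<le> \<theta>" using \<open>\<not> \<theta> \<le> 0\<close> by (simp only: mult_le_cancel_left_pos not_le)
      have "(\<Sum>\<sigma>\<in>UNIV. w \<sigma> / c \<sigma> * (y \<sigma>)\<^sup>2) = v \<bullet> v"
      proof -
        have "w \<sigma> / c \<sigma> * (y \<sigma>)\<^sup>2 = v $ \<sigma> * v $ \<sigma>" for \<sigma>
        proof -
          have "w \<sigma> / c \<sigma> * (y \<sigma>)\<^sup>2 = w \<sigma> / c \<sigma> * (g \<sigma> * g \<sigma>) * (v $ \<sigma> * v $ \<sigma>)"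
            by (simp add: y_def power2_eq_square mult_ac)
          then show ?thesis using c[of \<sigma>] w[of \<sigma>] by (simp add: g(2))
        qed
        then show ?thesis by (simp add: inner_vec_def)
      qed
      \<comment> \<open>The diagonal form at \<open>y\<close> equals 1 and \<open>qf A y y\<close>
        is \<open>\<theta> \<ge> 1\<close>, so the Dirichlet form is non-positive; its terms are
        nonnegative and therefore all vanish.\<close>
      then have "(\<Sum>\<sigma>\<in>UNIV. \<Sum>\<tau>\<in>UNIV. A \<sigma> \<tau> * c \<sigma> * c \<tau> * (y \<sigma> / c \<sigma> - y \<tau> / c \<tau>)\<^sup>2) \<le> 0"
        using rayleigh_gap[of A c y, OF sym c] \<open>1 \<le> \<theta>\<close> by (simp add: w_def qy vv)
      moreover have nn: "A \<sigma> \<tau> * c \<sigma> * c \<tau> * (y \<sigma> / c \<sigma> - y \<tau> / c \<tau>)\<^sup>2 \<ge> 0" for \<sigma> \<tau>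
        using pos[of \<sigma> \<tau>] c[of \<sigma>] c[of \<tau>] by simp
      ultimately have "(\<Sum>\<sigma>\<in>UNIV. \<Sum>\<tau>\<in>UNIV. A \<sigma> \<tau> * c \<sigma> * c \<tau> * (y \<sigma> / c \<sigma> - y \<tau> / c \<tau>)\<^sup>2) = 0"
        by (intro order_antisym sum_nonneg)
      then have "A \<sigma> \<tau> * c \<sigma> * c \<tau> * (y \<sigma> / c \<sigma> - y \<tau> / c \<tau>)\<^sup>2 = 0" for \<sigma> \<tau>
        using nn by (simp add: sum_nonneg_eq_0_iff sum_nonneg)
      then have eq: "y \<sigma> / c \<sigma> = y \<tau> / c \<tau>" for \<sigma> \<tau>
        using pos[of \<sigma> \<tau>] c[of \<sigma>] c[of \<tau>] by (metis less_irrefl mult_eq_0_iff power2_eq_square right_minus_eq)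
      \<comment> \<open>The ratios \<open>y / c\<close> agree, so \<open>v\<close> is a multiple of
        \<open>v0\<close>, contradicting orthogonality to \<open>v0\<close>.\<close>
      define k where "k = y undefined / c undefined"
      have "y \<sigma> = k * c \<sigma>" for \<sigma>
        using eq[of \<sigma> undefined] c[of \<sigma>] by (simp add: k_def field_simps)
      then have "v $ \<sigma> = k * v0 $ \<sigma>" for \<sigma>
        using g(1)[of \<sigma>] by (simp add: y_def v0_def field_simps)
      then have "v = k *\<^sub>R v0" by (simp add: vec_eq_iff)
      then have "v \<bullet> v = k * (v0 \<bullet> v)" by (metis inner_scaleR_left)
      then show False using v(1) vv by (simp add: S_def)
    qed
    then show ?thesis using b[OF that] by (smt (verit) inner_ge_zero mult_nonpos_nonneg)
  qed (use that in auto)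
  show ?thesis
    unfolding lorentzian_def
  proof (intro exI[of _ w] allI impI)
    fix x assume x: "(\<Sum>\<sigma>\<in>UNIV. w \<sigma> * x \<sigma>) = 0"
    define z :: "real^'i" where "z = (\<chi> \<sigma>. x \<sigma> / g \<sigma>)"
    have xz: "x = (\<lambda>\<sigma>. g \<sigma> * z $ \<sigma>)"
      using g(1) by (simp add: z_def less_imp_neq[THEN not_sym])
    have "v0 $ \<sigma> * z $ \<sigma> = w \<sigma> * x \<sigma>" for \<sigma>
      using g(1)[of \<sigma>] by (simp add: v0_alt z_def)
    then have "z \<in> S" using x by (simp add: S_def inner_vec_def)
    then show "qf A x x \<le> 0" using main[of z] by (simp only: xz qfM)
  qed
qed

section \<open>Partition functions of complete graphs\<close>

text \<open>The partition function of a complete graph, exposing one vertex at a time: fixing its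
  spin \<open>\<sigma>\<close> multiplies the other fugacities by the row \<open>K \<sigma>\<close>.
  \<open>Z_inhom_complete\<close> proves the agreement with the graph definition.\<close>

primrec clique_sum :: "('i::finite \<Rightarrow> 'i \<Rightarrow> real) \<Rightarrow> nat \<Rightarrow> ('i \<Rightarrow> real) \<Rightarrow> real" where
  "clique_sum K 0 a = 1"
| "clique_sum K (Suc n) a = (\<Sum>\<sigma>\<in>UNIV. a \<sigma> * clique_sum K n (\<lambda>\<tau>. a \<tau> * K \<sigma> \<tau>))"

section \<open>Positivity, monotonicity, homogeneity and continuity of clique sums\<close>

lemma clique_sum_nonneg:
  assumes "\<And>\<sigma> \<tau>. 0 \<le> K \<sigma> \<tau>"
  shows "(\<And>\<sigma>. 0 \<le> a \<sigma>) \<Longrightarrow> 0 \<le> clique_sum K n a"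
proof (induction n arbitrary: a)
  case (Suc n)
  show ?case
    unfolding clique_sum.simps by (intro sum_nonneg mult_nonneg_nonneg Suc assms)
qed simp

lemma clique_sum_pos:
  assumes "\<And>\<sigma> \<tau>. 0 < K \<sigma> \<tau>"
  shows "(\<And>\<sigma>. 0 < a \<sigma>) \<Longrightarrow> 0 < clique_sum K n a"
proof (induction n arbitrary: a)
  case (Suc n)
  show ?case
    unfolding clique_sum.simps by (intro sum_pos mult_pos_pos Suc assms) auto
qed simp

lemma clique_sum_mono:
  assumes "\<And>\<sigma> \<tau>. 0 \<le> K \<sigma> \<tau>"
  shows "(\<And>\<sigma>. 0 \<le> a \<sigma>) \<Longrightarrow> (\<And>\<sigma>. a \<sigma> \<le> b \<sigma>) \<Longrightarrow> clique_sum K n a \<le> clique_sum K n b"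
proof (induction n arbitrary: a b)
  case (Suc n)
  have b: "0 \<le> b \<sigma>" for \<sigma> using Suc.prems by (meson order_trans)
  show ?case
    by (auto intro!: sum_mono mult_mono Suc.IH clique_sum_nonneg mult_nonneg_nonneg
        mult_right_mono assms Suc.prems b)
qed simp

lemma clique_sum_scale: "clique_sum K n (\<lambda>\<sigma>. c * a \<sigma>) = c ^ n * clique_sum K n a"
proof (induction n arbitrary: a)
  case (Suc n)
  show ?case
    using Suc[of "\<lambda>\<tau>. a \<tau> * K _ \<tau>"] by (simp add: mult.assoc sum_distrib_left) (simp add: mult_ac)
qed simp

lemma clique_sum_tendsto:
  assumes "\<And>\<sigma> \<tau>. ((\<lambda>x. K x \<sigma> \<tau>) \<longlongrightarrow> K' \<sigma> \<tau>) F"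
  shows "(\<And>\<sigma>. ((\<lambda>x. a x \<sigma>) \<longlongrightarrow> a' \<sigma>) F) \<Longrightarrow> ((\<lambda>x. clique_sum (K x) n (a x)) \<longlongrightarrow> clique_sum K' n a') F"
proof (induction n arbitrary: a a')
  case (Suc n)
  show ?case
    by (auto intro!: tendsto_sum tendsto_mult Suc assms)
qed simp

lemma continuous_on_clique_sum:
  "continuous_on S (\<lambda>x. clique_sum K n (\<lambda>\<sigma>. x $ \<sigma>))"
  unfolding continuous_on_def by (auto intro!: clique_sum_tendsto tendsto_vec_nth tendsto_ident_at)

text \<open>First-order Taylor bound: \<open>Suc n\<close> times the link sum at
  \<open>\<sigma>\<close> is the partial derivative at \<open>a\<close>, and the omitted higher
  terms have nonnegative coefficients.\<close>

lemma clique_sum_tangent: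
  assumes sym: "\<And>\<sigma> \<tau>. K \<sigma> \<tau> = K \<tau> \<sigma>" and K: "\<And>\<sigma> \<tau>. 0 \<le> K \<sigma> \<tau>"
  shows "(\<And>\<sigma>. 0 \<le> a \<sigma>) \<Longrightarrow> (\<And>\<sigma>. 0 \<le> b \<sigma>) \<Longrightarrow>
    clique_sum K (Suc n) a + (Suc n) * (\<Sum>\<sigma>\<in>UNIV. b \<sigma> * clique_sum K n (\<lambda>\<tau>. a \<tau> * K \<sigma> \<tau>))
      \<le> clique_sum K (Suc n) (\<lambda>\<sigma>. a \<sigma> + b \<sigma>)"
proof (induction n arbitrary: a b)
  case 0
  then show ?case by (simp add: sum.distrib)
next
  case (Suc n)
  define Q where "Q \<sigma> \<tau> = clique_sum K n (\<lambda>\<rho>. a \<rho> * K \<sigma> \<rho> * K \<tau> \<rho>)" for \<sigma> \<tau>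
  have IH: "clique_sum K (Suc n) (\<lambda>\<tau>. a \<tau> * K \<sigma> \<tau>) + (Suc n) * (\<Sum>\<tau>\<in>UNIV. b \<tau> * K \<sigma> \<tau> * Q \<sigma> \<tau>)
    \<le> clique_sum K (Suc n) (\<lambda>\<tau>. (a \<tau> + b \<tau>) * K \<sigma> \<tau>)" for \<sigma>
    using Suc.IH[of "\<lambda>\<tau>. a \<tau> * K \<sigma> \<tau>" "\<lambda>\<tau>. b \<tau> * K \<sigma> \<tau>"] Suc.prems K
    by (simp add: Q_def distrib_right del: clique_sum.simps)
  have mono: "clique_sum K (Suc n) (\<lambda>\<tau>. a \<tau> * K \<sigma> \<tau>) \<le> clique_sum K (Suc n) (\<lambda>\<tau>. (a \<tau> + b \<tau>) * K \<sigma> \<tau>)" for \<sigma>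
    by (intro clique_sum_mono K mult_right_mono mult_nonneg_nonneg) (use Suc.prems in auto)
  \<comment> \<open>Symmetry of \<open>K\<close> allows the first two exposed vertices to be
    exchanged.\<close>
  have swap: "(\<Sum>\<sigma>\<in>UNIV. a \<sigma> * (\<Sum>\<tau>\<in>UNIV. b \<tau> * K \<sigma> \<tau> * Q \<sigma> \<tau>))
      = (\<Sum>\<tau>\<in>UNIV. b \<tau> * clique_sum K (Suc n) (\<lambda>\<rho>. a \<rho> * K \<tau> \<rho>))"
  proof -
    have "(\<Sum>\<sigma>\<in>UNIV. a \<sigma> * (\<Sum>\<tau>\<in>UNIV. b \<tau> * K \<sigma> \<tau> * Q \<sigma> \<tau>))
      = (\<Sum>\<sigma>\<in>UNIV. \<Sum>\<tau>\<in>UNIV. b \<tau> * (a \<sigma> * K \<tau> \<sigma> * Q \<sigma> \<tau>))"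
      by (simp add: sum_distrib_left sym mult_ac)
    also have "\<dots> = (\<Sum>\<tau>\<in>UNIV. b \<tau> * (\<Sum>\<sigma>\<in>UNIV. a \<sigma> * K \<tau> \<sigma> * Q \<sigma> \<tau>))"
      by (subst sum.swap) (simp only: sum_distrib_left)
    also have "\<dots> = (\<Sum>\<tau>\<in>UNIV. b \<tau> * clique_sum K (Suc n) (\<lambda>\<rho>. a \<rho> * K \<tau> \<rho>))"
      by (simp add: Q_def mult_ac)
    finally show ?thesis .
  qed
  have "clique_sum K (Suc (Suc n)) (\<lambda>\<sigma>. a \<sigma> + b \<sigma>)
    = (\<Sum>\<sigma>\<in>UNIV. a \<sigma> * clique_sum K (Suc n) (\<lambda>\<tau>. (a \<tau> + b \<tau>) * K \<sigma> \<tau>))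
      + (\<Sum>\<sigma>\<in>UNIV. b \<sigma> * clique_sum K (Suc n) (\<lambda>\<tau>. (a \<tau> + b \<tau>) * K \<sigma> \<tau>))"
    unfolding clique_sum.simps(2)[of K "Suc n"] distrib_right[of "a _"] sum.distrib ..
  also have "\<dots> \<ge> (\<Sum>\<sigma>\<in>UNIV. a \<sigma> * (clique_sum K (Suc n) (\<lambda>\<tau>. a \<tau> * K \<sigma> \<tau>) +
        (Suc n) * (\<Sum>\<tau>\<in>UNIV. b \<tau> * K \<sigma> \<tau> * Q \<sigma> \<tau>)))
      + (\<Sum>\<sigma>\<in>UNIV. b \<sigma> * clique_sum K (Suc n) (\<lambda>\<tau>. a \<tau> * K \<sigma> \<tau>))"
    by (intro add_mono sum_mono mult_left_mono IH mono Suc.prems)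
  moreover have "(\<Sum>\<sigma>\<in>UNIV. a \<sigma> * (clique_sum K (Suc n) (\<lambda>\<tau>. a \<tau> * K \<sigma> \<tau>) +
        (Suc n) * (\<Sum>\<tau>\<in>UNIV. b \<tau> * K \<sigma> \<tau> * Q \<sigma> \<tau>)))
    = clique_sum K (Suc (Suc n)) a + (Suc n) * (\<Sum>\<sigma>\<in>UNIV. a \<sigma> * (\<Sum>\<tau>\<in>UNIV. b \<tau> * K \<sigma> \<tau> * Q \<sigma> \<tau>))"
    unfolding clique_sum.simps(2)[of K "Suc n"] distrib_left sum.distrib
    by (simp add: sum_distrib_left mult_ac del: clique_sum.simps)
  ultimately show ?case
    unfolding swap by (simp add: algebra_simps del: clique_sum.simps)
qed

text \<open>A maximiser on the face \<open>S\<close> of the simplex cut out by pairing to 1 with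
  \<open>w\<close>. Maximality is stated homogeneously, so it applies to vectors on the face without
  normalising them.\<close>

definition maximiser_on ::
    "('i \<Rightarrow> real) \<Rightarrow> 'i set \<Rightarrow> ('i::finite \<Rightarrow> 'i \<Rightarrow> real) \<Rightarrow> nat \<Rightarrow> ('i \<Rightarrow> real) \<Rightarrow> bool" where
  "maximiser_on w S K n p \<longleftrightarrow>
    (\<forall>\<sigma>. 0 \<le> p \<sigma>) \<and> (\<forall>\<sigma>. \<sigma> \<notin> S \<longrightarrow> p \<sigma> = 0) \<and> (\<Sum>\<sigma>\<in>UNIV. p \<sigma> * w \<sigma>) = 1 \<and>
    (\<forall>l. (\<forall>\<sigma>. 0 \<le> l \<sigma>) \<longrightarrow> (\<forall>\<sigma>. \<sigma> \<notin> S \<longrightarrow> l \<sigma> = 0) \<longrightarrow>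
      clique_sum K n l \<le> clique_sum K n p * (\<Sum>\<sigma>\<in>UNIV. l \<sigma> * w \<sigma>) ^ n)"

lemma maximiser_onD:
  assumes "maximiser_on w S K n p"
  shows "0 \<le> p \<sigma>" "\<sigma> \<notin> S \<Longrightarrow> p \<sigma> = 0" "(\<Sum>\<sigma>\<in>UNIV. p \<sigma> * w \<sigma>) = 1"
    "(\<And>\<sigma>. 0 \<le> l \<sigma>) \<Longrightarrow> (\<And>\<sigma>. \<sigma> \<notin> S \<Longrightarrow> l \<sigma> = 0) \<Longrightarrow>
      clique_sum K n l \<le> clique_sum K n p * (\<Sum>\<sigma>\<in>UNIV. l \<sigma> * w \<sigma>) ^ n"
  using assms by (auto simp: maximiser_on_def)

text \<open>First-order optimality. The tangent bound and homogeneous maximality, compared along a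
  coordinate direction with step tending to 0, give the inequality; complementary slackness gives
  equality where \<open>p\<close> is positive.\<close>

lemma maximiser_on_gradient:
  assumes sym: "\<And>\<sigma> \<tau>. K \<sigma> \<tau> = K \<tau> \<sigma>" and K: "\<And>\<sigma> \<tau>. 0 \<le> K \<sigma> \<tau>"
    and mx: "maximiser_on w S K (Suc n) p"
  shows "\<sigma> \<in> S \<Longrightarrow> clique_sum K n (\<lambda>\<tau>. p \<tau> * K \<sigma> \<tau>) \<le> clique_sum K (Suc n) p * w \<sigma>"
    and "0 < p \<sigma> \<Longrightarrow> clique_sum K n (\<lambda>\<tau>. p \<tau> * K \<sigma> \<tau>) = clique_sum K (Suc n) p * w \<sigma>"
proof -
  note p = maximiser_onD(1-3)[OF mx] and max = maximiser_onD(4)[OF mx]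
  define M where "M = clique_sum K (Suc n) p"
  define D where "D \<sigma> = clique_sum K n (\<lambda>\<tau>. p \<tau> * K \<sigma> \<tau>)" for \<sigma>
  have le: "D \<sigma> \<le> M * w \<sigma>" if "\<sigma> \<in> S" for \<sigma>
  proof -
    have step: "real (Suc n) * D \<sigma> \<le> M * (((1 + h * w \<sigma>) ^ Suc n - 1) / h)" if h: "h > 0" for h
    proof -
      define b where "b \<tau> = (if \<tau> = \<sigma> then h else 0)" for \<tau>
      have b0: "0 \<le> b \<tau>" for \<tau> using h by (simp add: b_def)
      have bsum: "(\<Sum>\<tau>\<in>UNIV. b \<tau> * f \<tau>) = h * f \<sigma>" for f :: "'a \<Rightarrow> real"
        by (simp add: b_def if_distrib if_distribR cong: if_cong)
      have "M + real (Suc n) * (h * D \<sigma>) \<le> clique_sum K (Suc n) (\<lambda>\<tau>. p \<tau> + b \<tau>)"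
        using clique_sum_tangent[of K p b n, OF sym K p(1) b0] unfolding bsum M_def D_def .
      also have "\<dots> \<le> M * (\<Sum>\<tau>\<in>UNIV. (p \<tau> + b \<tau>) * w \<tau>) ^ Suc n"
        unfolding M_def by (rule max) (use p b0 \<open>\<sigma> \<in> S\<close> in \<open>auto simp: b_def\<close>)
      also have "(\<Sum>\<tau>\<in>UNIV. (p \<tau> + b \<tau>) * w \<tau>) = 1 + h * w \<sigma>"
        by (simp only: distrib_right sum.distrib bsum p(3))
      finally show ?thesis using h by (simp add: field_simps)
    qed
    have "((\<lambda>h. ((1 + h * w \<sigma>) ^ Suc n - 1) / h) \<longlongrightarrow> real (Suc n) * w \<sigma>) (at 0)"
    proof -
      have "((\<lambda>h. (1 + h * w \<sigma>) ^ Suc n) has_field_derivative real (Suc n) * w \<sigma>) (at 0)"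
        by (rule derivative_eq_intros refl | simp)+
      then show ?thesis by (simp add: has_field_derivative_iff)
    qed
    then have lim: "((\<lambda>h. M * (((1 + h * w \<sigma>) ^ Suc n - 1) / h)) \<longlongrightarrow> M * (real (Suc n) * w \<sigma>)) (at_right 0)"
      by (intro tendsto_intros) (rule filterlim_mono[OF _ order_refl at_le], auto)
    have "real (Suc n) * D \<sigma> \<le> M * (real (Suc n) * w \<sigma>)"
      by (rule tendsto_lowerbound[OF lim]) (use step in \<open>auto simp: eventually_at_right_less eventually_at_filter\<close>)
    then have "real (Suc n) * D \<sigma> \<le> real (Suc n) * (M * w \<sigma>)" by (simp add: mult_ac)
    then show ?thesis by (simp only: mult_le_cancel_left_pos of_nat_0_less_iff zero_less_Suc)
  qed
  then show "\<sigma> \<in> S \<Longrightarrow> clique_sum K n (\<lambda>\<tau>. p \<tau> * K \<sigma> \<tau>) \<le> clique_sum K (Suc n) p * w \<sigma>"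
    unfolding D_def M_def .
  have nn: "0 \<le> p \<tau> * (M * w \<tau> - D \<tau>)" for \<tau>
    using le[of \<tau>] p(1,2)[of \<tau>] by (cases "\<tau> \<in> S") auto
  \<comment> \<open>Euler's identity: it makes the nonnegative slacks, weighted by \<open>p\<close>,
    sum to zero.\<close>
  have "M = (\<Sum>\<tau>\<in>UNIV. p \<tau> * D \<tau>)" by (simp add: M_def D_def)
  moreover have "(\<Sum>\<tau>\<in>UNIV. p \<tau> * (M * w \<tau> - D \<tau>))
      = M * (\<Sum>\<tau>\<in>UNIV. p \<tau> * w \<tau>) - (\<Sum>\<tau>\<in>UNIV. p \<tau> * D \<tau>)"
    by (simp add: right_diff_distrib sum_subtractf sum_distrib_left mult_ac)
  ultimately have "(\<Sum>\<tau>\<in>UNIV. p \<tau> * (M * w \<tau> - D \<tau>)) = 0" by (simp add: p(3))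
  then have z: "p \<tau> * (M * w \<tau> - D \<tau>) = 0" for \<tau>
    using nn by (simp add: sum_nonneg_eq_0_iff)
  show "0 < p \<sigma> \<Longrightarrow> clique_sum K n (\<lambda>\<tau>. p \<tau> * K \<sigma> \<tau>) = clique_sum K (Suc n) p * w \<sigma>"
    using z[of \<sigma>] by (simp add: M_def D_def)
qed

text \<open>Positivity of \<open>w\<close> bounds every coordinate, so the face is compact;
  homogeneity then extends maximality to all scales.\<close>

lemma maximiser_on_exists:
  fixes K :: "'i::finite \<Rightarrow> 'i \<Rightarrow> real"
  assumes w: "\<And>\<sigma>. 0 < w \<sigma>" and "S \<noteq> {}"
  obtains p where "maximiser_on w S K (Suc n) p"
proof -
  define T where "T = {x :: real^'i. (\<forall>\<sigma>. 0 \<le> x $ \<sigma>) \<and> (\<forall>\<sigma>. \<sigma> \<notin> S \<longrightarrow> x $ \<sigma> = 0) \<and> (\<Sum>\<sigma>\<in>UNIV. x $ \<sigma> * w \<sigma>) = 1}"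
  have "T = {x. \<forall>\<sigma>. 0 \<le> x $ \<sigma>} \<inter> {x. \<forall>\<sigma>. \<sigma> \<notin> S \<longrightarrow> x $ \<sigma> = 0} \<inter> {x. (\<Sum>\<sigma>\<in>UNIV. x $ \<sigma> * w \<sigma>) = 1}"
    by (auto simp: T_def)
  moreover have "closed {x :: real^'i. \<forall>\<sigma>. 0 \<le> x $ \<sigma>}"
    by (intro closed_Collect_all closed_Collect_le continuous_intros)
  moreover have "closed {x :: real^'i. \<forall>\<sigma>. \<sigma> \<notin> S \<longrightarrow> x $ \<sigma> = 0}"
    by (intro closed_Collect_all closed_Collect_imp open_Collect_const closed_Collect_eq continuous_intros)
  moreover have "closed {x :: real^'i. (\<Sum>\<sigma>\<in>UNIV. x $ \<sigma> * w \<sigma>) = 1}"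
    by (intro closed_Collect_eq continuous_intros)
  ultimately have "closed T" by (simp add: closed_Int)
  have "T \<subseteq> cbox 0 (\<chi> \<sigma>. 1 / w \<sigma>)"
  proof
    fix x assume x: "x \<in> T"
    have "x $ \<sigma> \<le> 1 / w \<sigma>" for \<sigma>
    proof -
      have "x $ \<sigma> * w \<sigma> \<le> (\<Sum>\<sigma>\<in>UNIV. x $ \<sigma> * w \<sigma>)"
        by (rule member_le_sum) (use x w in \<open>auto simp: T_def less_imp_le\<close>)
      then show ?thesis using x w[of \<sigma>] by (simp add: T_def field_simps)
    qed
    then show "x \<in> cbox 0 (\<chi> \<sigma>. 1 / w \<sigma>)" using x by (simp add: mem_box_cart T_def)
  qed
  then have "compact T" using \<open>closed T\<close> bounded_cbox bounded_subset compact_eq_bounded_closed by blast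
  obtain \<sigma>0 where "\<sigma>0 \<in> S" using assms(2) by blast
  have "(\<chi> \<sigma>. if \<sigma> = \<sigma>0 then 1 / w \<sigma>0 else 0) \<in> T"
    using \<open>\<sigma>0 \<in> S\<close> w[of \<sigma>0] by (auto simp: T_def less_imp_le if_distrib if_distribR cong: if_cong)
  then have "T \<noteq> {}" by blast
  from continuous_attains_sup[OF \<open>compact T\<close> this continuous_on_clique_sum]
  obtain x where x: "x \<in> T"
    and max: "\<And>y. y \<in> T \<Longrightarrow> clique_sum K (Suc n) (\<lambda>\<sigma>. y $ \<sigma>) \<le> clique_sum K (Suc n) (\<lambda>\<sigma>. x $ \<sigma>)"
    by metis
  have "clique_sum K (Suc n) l \<le> clique_sum K (Suc n) (\<lambda>\<sigma>. x $ \<sigma>) * (\<Sum>\<sigma>\<in>UNIV. l \<sigma> * w \<sigma>) ^ Suc n"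
    if l: "\<And>\<sigma>. 0 \<le> l \<sigma>" "\<And>\<sigma>. \<sigma> \<notin> S \<Longrightarrow> l \<sigma> = 0" for l
  proof -
    define s where "s = (\<Sum>\<sigma>\<in>UNIV. l \<sigma> * w \<sigma>)"
    show ?thesis
    proof (cases "s = 0")
      case True
      then have "l \<sigma> * w \<sigma> = 0" for \<sigma>
        using l(1) w by (simp add: s_def sum_nonneg_eq_0_iff less_imp_le)
      then have "l \<sigma> = 0" for \<sigma> using w[of \<sigma>] by (metis less_irrefl mult_eq_0_iff)
      then show ?thesis by simp
    next
      case False
      moreover have "s \<ge> 0"
        unfolding s_def by (intro sum_nonneg mult_nonneg_nonneg l less_imp_le[OF w])
      ultimately have "s > 0" by simp
      have "(\<chi> \<sigma>. l \<sigma> / s) \<in> T"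
        using l \<open>s > 0\<close> by (auto simp: T_def s_def sum_divide_distrib[symmetric])
      from max[OF this] have "clique_sum K (Suc n) (\<lambda>\<sigma>. l \<sigma> / s) \<le> clique_sum K (Suc n) (\<lambda>\<sigma>. x $ \<sigma>)"
        by (simp del: clique_sum.simps)
      then have "s ^ Suc n * clique_sum K (Suc n) (\<lambda>\<sigma>. l \<sigma> / s) \<le> s ^ Suc n * clique_sum K (Suc n) (\<lambda>\<sigma>. x $ \<sigma>)"
        using \<open>s > 0\<close> by (intro mult_left_mono) auto
      also have "s ^ Suc n * clique_sum K (Suc n) (\<lambda>\<sigma>. l \<sigma> / s) = clique_sum K (Suc n) l"
        unfolding clique_sum_scale[symmetric] using \<open>s > 0\<close> by (simp del: clique_sum.simps)
      finally show ?thesis by (simp only: s_def mult.commute)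
    qed
  qed
  then have "maximiser_on w S K (Suc n) (\<lambda>\<sigma>. x $ \<sigma>)"
    using x by (simp add: maximiser_on_def T_def del: clique_sum.simps)
  then show thesis by (rule that)
qed

text \<open>Up to the factor \<open>(n + 2) * (n + 1)\<close> this is the Hessian at
  \<open>q\<close> of the clique sum of order \<open>n + 2\<close>. By Euler's relation it is a
  \<open>q\<close>-weighted sum of Hessians one order lower, as \<open>lorentzian_step\<close>
  requires.\<close>

lemma lorentzian_hessian:
  fixes K :: "'i::finite \<Rightarrow> 'i \<Rightarrow> real"
  assumes sym: "\<And>\<sigma> \<tau>. K \<sigma> \<tau> = K \<tau> \<sigma>" and K: "\<And>\<sigma> \<tau>. 0 < K \<sigma> \<tau>" and lor: "lorentzian K"
  shows "(\<And>\<sigma>. 0 < q \<sigma>) \<Longrightarrow> lorentzian (\<lambda>\<sigma> \<tau>. K \<sigma> \<tau> * clique_sum K n (\<lambda>\<rho>. q \<rho> * K \<sigma> \<rho> * K \<tau> \<rho>))"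
proof (induction n arbitrary: q)
  case 0
  show ?case using lor by simp
next
  case (Suc n)
  \<comment> \<open>The Hessian in the link of \<open>\<rho>\<close>, at fugacities
    \<open>q \<nu> * K \<rho> \<nu>\<close>, rescaled diagonally by the row
    \<open>K \<rho>\<close>.\<close>
  define B where "B \<rho> \<sigma> \<tau> = K \<rho> \<sigma> * K \<rho> \<tau> *
      (K \<sigma> \<tau> * clique_sum K n (\<lambda>\<nu>. (q \<nu> * K \<rho> \<nu>) * K \<sigma> \<nu> * K \<tau> \<nu>))" for \<rho> \<sigma> \<tau>
  show ?case
  proof (rule lorentzian_step[where c = q and B = B])
    show "K \<sigma> \<tau> * clique_sum K (Suc n) (\<lambda>\<rho>. q \<rho> * K \<sigma> \<rho> * K \<tau> \<rho>)
      = K \<tau> \<sigma> * clique_sum K (Suc n) (\<lambda>\<rho>. q \<rho> * K \<tau> \<rho> * K \<sigma> \<rho>)" for \<sigma> \<tau>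
      by (subst sym[of \<sigma> \<tau>]) (simp only: mult_ac)
    show "0 < K \<sigma> \<tau> * clique_sum K (Suc n) (\<lambda>\<rho>. q \<rho> * K \<sigma> \<rho> * K \<tau> \<rho>)" for \<sigma> \<tau>
      by (intro mult_pos_pos clique_sum_pos K Suc.prems)
    show "K \<sigma> \<tau> * clique_sum K (Suc n) (\<lambda>\<rho>. q \<rho> * K \<sigma> \<rho> * K \<tau> \<rho>) = (\<Sum>\<rho>\<in>UNIV. q \<rho> * B \<rho> \<sigma> \<tau>)" for \<sigma> \<tau>
    proof -
      have "K \<sigma> \<tau> * (q \<rho> * K \<sigma> \<rho> * K \<tau> \<rho> * clique_sum K n (\<lambda>\<nu>. q \<nu> * K \<sigma> \<nu> * K \<tau> \<nu> * K \<rho> \<nu>)) = q \<rho> * B \<rho> \<sigma> \<tau>" for \<rho>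
        unfolding B_def sym[of \<rho> \<sigma>] sym[of \<rho> \<tau>] by (simp only: mult_ac)
      then show ?thesis by (simp only: clique_sum.simps sum_distrib_left)
    qed
    show "(\<Sum>\<tau>\<in>UNIV. B \<rho> \<sigma> \<tau> * q \<tau>) = K \<rho> \<sigma> * clique_sum K (Suc n) (\<lambda>\<nu>. q \<nu> * K \<rho> \<nu> * K \<sigma> \<nu>)" for \<rho> \<sigma>
    proof -
      have "B \<rho> \<sigma> \<tau> * q \<tau> = K \<rho> \<sigma> * (q \<tau> * K \<rho> \<tau> * K \<sigma> \<tau> * clique_sum K n (\<lambda>\<nu>. q \<nu> * K \<rho> \<nu> * K \<sigma> \<nu> * K \<tau> \<nu>))" for \<tau>
        unfolding B_def by (simp only: mult_ac)
      then show ?thesis by (simp only: clique_sum.simps sum_distrib_left)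
    qed
    show "lorentzian (B \<rho>)" for \<rho>
      unfolding B_def by (intro lorentzian_diagonal Suc.IH mult_pos_pos Suc.prems K)
    show "B \<rho> \<sigma> \<tau> = B \<rho> \<tau> \<sigma>" for \<rho> \<sigma> \<tau>
      unfolding B_def by (subst sym[of \<sigma> \<tau>]) (simp only: mult_ac)
  qed (rule Suc.prems)
qed

text \<open>At a maximiser \<open>p\<close> normalised by \<open>w\<close>, the inequality one order lower at the link of each \<open>\<sigma>\<close>
  in the support of \<open>p\<close> gives \<open>A p \<ge> r w\<close>, where \<open>r ^ Suc n\<close> is the maximum; the Lorentzian
  inequality for the Hessian \<open>A\<close> at \<open>q\<close> then bounds \<open>r\<close>.\<close>

lemma reverse_ineq_pos:
  fixes K :: "'i::finite \<Rightarrow> 'i \<Rightarrow> real"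
  assumes sym: "\<And>\<sigma> \<tau>. K \<sigma> \<tau> = K \<tau> \<sigma>" and K: "\<And>\<sigma> \<tau>. 0 < K \<sigma> \<tau>" and lor: "lorentzian K"
  shows "(\<And>\<sigma>. 0 \<le> l \<sigma>) \<Longrightarrow> (\<And>\<sigma>. 0 < q \<sigma>) \<Longrightarrow>
    clique_sum K (Suc n) l * clique_sum K (Suc n) q ^ n
      \<le> (\<Sum>\<sigma>\<in>UNIV. l \<sigma> * clique_sum K n (\<lambda>\<tau>. q \<tau> * K \<sigma> \<tau>)) ^ Suc n"
proof (induction n arbitrary: l q)
  case 0
  then show ?case by simp
next
  case (Suc n)
  define w where "w \<sigma> = clique_sum K (Suc n) (\<lambda>\<tau>. q \<tau> * K \<sigma> \<tau>)" for \<sigma>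
  have w: "0 < w \<sigma>" for \<sigma> unfolding w_def by (intro clique_sum_pos mult_pos_pos K Suc.prems)
  have K0: "0 \<le> K \<sigma> \<tau>" for \<sigma> \<tau> using K[of \<sigma> \<tau>] by simp
  obtain p where mx: "maximiser_on w UNIV K (Suc (Suc n)) p"
    by (rule maximiser_on_exists[OF w UNIV_not_empty])
  note p = maximiser_onD(1,3)[OF mx]
  define M where "M = clique_sum K (Suc (Suc n)) p"
  \<comment> \<open>The root has order one less than the clique sum defining \<open>M\<close>, to
    match the exponent of the inequality in the links.\<close>
  define r where "r = root (Suc n) M"
  have "0 \<le> M" unfolding M_def by (intro clique_sum_nonneg K0 p)
  then have r: "0 \<le> r" "r ^ Suc n = M" unfolding r_def by (simp_all del: power_Suc)
  have grad: "clique_sum K (Suc n) (\<lambda>\<tau>. p \<tau> * K \<sigma> \<tau>) = M * w \<sigma>" if "0 < p \<sigma>" for \<sigma>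
    unfolding M_def
    by (rule maximiser_on_gradient(2)[OF sym K0 mx that])
  define A where "A \<sigma> \<tau> = K \<sigma> \<tau> * clique_sum K n (\<lambda>\<rho>. q \<rho> * K \<sigma> \<rho> * K \<tau> \<rho>)" for \<sigma> \<tau>
  have Asym: "A \<sigma> \<tau> = A \<tau> \<sigma>" for \<sigma> \<tau>
    unfolding A_def by (subst sym[of \<sigma> \<tau>]) (simp only: mult_ac)
  have Aq: "(\<Sum>\<tau>\<in>UNIV. A \<sigma> \<tau> * q \<tau>) = w \<sigma>" for \<sigma>
    by (simp add: A_def w_def mult_ac)
  \<comment> \<open>The induction hypothesis for the links of \<open>\<sigma>\<close> in
    \<open>p\<close> and \<open>q\<close>: their clique sums are \<open>M * w \<sigma>\<close> and
    \<open>w \<sigma>\<close>, so its left side is \<open>(r * w \<sigma>) ^ Suc n\<close>.\<close>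
  have Ap: "r * w \<sigma> \<le> (\<Sum>\<tau>\<in>UNIV. A \<sigma> \<tau> * p \<tau>)" if "0 < p \<sigma>" for \<sigma>
  proof (rule power_le_imp_le_base)
    have "(r * w \<sigma>) ^ Suc n = M * w \<sigma> * w \<sigma> ^ n"
      by (simp add: power_mult_distrib r(2) del: power_Suc) simp
    also have "\<dots> = clique_sum K (Suc n) (\<lambda>\<tau>. p \<tau> * K \<sigma> \<tau>) * clique_sum K (Suc n) (\<lambda>\<tau>. q \<tau> * K \<sigma> \<tau>) ^ n"
      unfolding grad[OF that] w_def ..
    also have "\<dots> \<le> (\<Sum>\<tau>\<in>UNIV. p \<tau> * K \<sigma> \<tau> * clique_sum K n (\<lambda>\<rho>. q \<rho> * K \<sigma> \<rho> * K \<tau> \<rho>)) ^ Suc n"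
      by (rule Suc.IH) (use p Suc.prems K K0 in auto)
    also have "(\<Sum>\<tau>\<in>UNIV. p \<tau> * K \<sigma> \<tau> * clique_sum K n (\<lambda>\<rho>. q \<rho> * K \<sigma> \<rho> * K \<tau> \<rho>)) = (\<Sum>\<tau>\<in>UNIV. A \<sigma> \<tau> * p \<tau>)"
      by (simp add: A_def mult_ac)
    finally show "(r * w \<sigma>) ^ Suc n \<le> (\<Sum>\<tau>\<in>UNIV. A \<sigma> \<tau> * p \<tau>) ^ Suc n" .
    show "0 \<le> (\<Sum>\<tau>\<in>UNIV. A \<sigma> \<tau> * p \<tau>)"
      unfolding A_def by (intro sum_nonneg mult_nonneg_nonneg clique_sum_nonneg K0 p less_imp_le[OF Suc.prems(2)])
  qed
  have qf_alt: "qf A x y = (\<Sum>\<sigma>\<in>UNIV. x \<sigma> * (\<Sum>\<tau>\<in>UNIV. A \<sigma> \<tau> * y \<tau>))" for x y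
    unfolding qf_def by (simp add: sum_distrib_left mult_ac)
  have "r = (\<Sum>\<sigma>\<in>UNIV. p \<sigma> * (r * w \<sigma>))"
    using p(2) by (simp add: mult.left_commute[of _ r] sum_distrib_left[symmetric])
  also have "\<dots> \<le> (\<Sum>\<sigma>\<in>UNIV. p \<sigma> * (\<Sum>\<tau>\<in>UNIV. A \<sigma> \<tau> * p \<tau>))"
  proof (rule sum_mono)
    show "p \<sigma> * (r * w \<sigma>) \<le> p \<sigma> * (\<Sum>\<tau>\<in>UNIV. A \<sigma> \<tau> * p \<tau>)" for \<sigma>
      using Ap[of \<sigma>] p(1)[of \<sigma>] by (cases "p \<sigma> = 0") (auto intro: mult_left_mono)
  qed
  also have "\<dots> = qf A p p" by (simp add: qf_alt)
  finally have rp: "r \<le> qf A p p" .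
  have qq: "qf A q q = clique_sum K (Suc (Suc n)) q"
    unfolding qf_alt Aq by (simp add: w_def)
  have qqpos: "0 < qf A q q" unfolding qq by (intro clique_sum_pos K Suc.prems)
  have "qf A p q = 1" unfolding qf_alt Aq by (rule p)
  moreover have "lorentzian A"
    unfolding A_def by (intro lorentzian_hessian sym K lor Suc.prems)
  ultimately have "qf A p p * qf A q q \<le> 1"
    using lorentzian_ineq[of A q p, OF _ Asym qqpos] by simp
  moreover have "r * qf A q q \<le> qf A p p * qf A q q"
    using rp qqpos by simp
  ultimately have "r * qf A q q \<le> 1" by linarith
  then have "(r * qf A q q) ^ Suc n \<le> 1"
    using r(1) qqpos by (intro power_le_one) auto
  \<comment> \<open>The claim at the maximiser \<open>p\<close>; homogeneous maximality transfers it
    to \<open>l\<close>.\<close>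
  then have le1: "M * clique_sum K (Suc (Suc n)) q ^ Suc n \<le> 1"
    by (simp only: power_mult_distrib r(2) qq)
  define s where "s = (\<Sum>\<sigma>\<in>UNIV. l \<sigma> * w \<sigma>) ^ Suc (Suc n)"
  have "0 \<le> s" unfolding s_def
    by (intro zero_le_power sum_nonneg mult_nonneg_nonneg Suc.prems less_imp_le[OF w])
  have "clique_sum K (Suc (Suc n)) l * clique_sum K (Suc (Suc n)) q ^ Suc n
      \<le> M * s * clique_sum K (Suc (Suc n)) q ^ Suc n"
    unfolding M_def s_def
    by (intro mult_right_mono maximiser_onD(4)[OF mx] Suc.prems zero_le_power less_imp_le[OF clique_sum_pos] K) auto
  also have "\<dots> = (M * clique_sum K (Suc (Suc n)) q ^ Suc n) * s" by (simp only: mult_ac)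
  also have "\<dots> \<le> 1 * s" using le1 \<open>0 \<le> s\<close> by (intro mult_right_mono)
  finally show ?case by (simp only: s_def w_def mult_1)
qed

text \<open>Strictly positive Lorentzian kernels tending to \<open>K\<close>, through which
  \<open>reverse_ineq_pos\<close> reaches kernels with zeros.\<close>

lemma lorentzian_perturbation:
  fixes K :: "'i::finite \<Rightarrow> 'i \<Rightarrow> real"
  assumes sym: "\<And>\<sigma> \<tau>. K \<sigma> \<tau> = K \<tau> \<sigma>" and K: "\<And>\<sigma> \<tau>. 0 \<le> K \<sigma> \<tau>" and lor: "lorentzian K"
  obtains P where "\<And>e \<sigma> \<tau>. P e \<sigma> \<tau> = P e \<tau> \<sigma>" "\<And>e \<sigma> \<tau>. 0 < e \<Longrightarrow> 0 < P e \<sigma> \<tau>"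
    "\<And>e. 0 < e \<Longrightarrow> lorentzian (P e)" "\<And>\<sigma> \<tau>. ((\<lambda>e. P e \<sigma> \<tau>) \<longlongrightarrow> K \<sigma> \<tau>) (at_right (0::real))"
proof (cases "\<exists>a b. K a b \<noteq> 0")
  case True
  then obtain a b where ab: "0 < K a b" using K by (metis order_le_less)
  \<comment> \<open>Congruence by the identity plus \<open>e\<close> times the all-ones matrix.\<close>
  define S where "S e \<sigma> \<rho> = (if \<rho> = \<sigma> then 1 else 0) + e" for e :: real and \<sigma> \<rho> :: 'i
  define P where "P e \<sigma> \<tau> = qf K (S e \<sigma>) (S e \<tau>)" for e \<sigma> \<tau>
  show ?thesis
  proof (rule that[of P])
    show "P e \<sigma> \<tau> = P e \<tau> \<sigma>" for e \<sigma> \<tau>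
      unfolding P_def by (rule qf_commute[OF sym])
    show "lorentzian (P e)" for e
      unfolding P_def by (rule lorentzian_congruence[OF lor])
    show "0 < P e \<sigma> \<tau>" if e: "0 < e" for e \<sigma> \<tau>
    proof -
      have S0: "0 < S e \<sigma> \<rho>" for \<sigma> \<rho> using e by (simp add: S_def)
      have t: "0 \<le> S e \<sigma> \<rho> * K \<rho> \<rho>' * S e \<tau> \<rho>'" for \<rho> \<rho>'
        by (intro mult_nonneg_nonneg K less_imp_le[OF S0])
      have "0 < (\<Sum>\<rho>'\<in>UNIV. S e \<sigma> a * K a \<rho>' * S e \<tau> \<rho>')"
        by (rule sum_pos2[of _ b]) (use ab S0 t in auto)
      then show ?thesis
        unfolding P_def qf_def by (rule sum_pos2[of _ a, rotated 2]) (auto intro!: sum_nonneg t)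
    qed
    show "((\<lambda>e. P e \<sigma> \<tau>) \<longlongrightarrow> K \<sigma> \<tau>) (at_right 0)" for \<sigma> \<tau>
    proof -
      have "((\<lambda>e. P e \<sigma> \<tau>) \<longlongrightarrow> qf K (S 0 \<sigma>) (S 0 \<tau>)) (at_right 0)"
        unfolding P_def qf_def S_def by (intro tendsto_intros)
      also have "qf K (S 0 \<sigma>) (S 0 \<tau>) = K \<sigma> \<tau>"
        using qf_delta[of K \<sigma> 1 \<tau> 1] by (simp add: S_def[abs_def])
      finally show ?thesis .
    qed
  qed
next
  case False
  \<comment> \<open>Congruence would leave the zero kernel unchanged. A constant kernel instead
    gives a form that vanishes on vectors of sum zero.\<close>
  show ?thesis
  proof (rule that[of "\<lambda>e \<sigma> \<tau>. e"])
    show "lorentzian (\<lambda>(\<sigma>::'i) (\<tau>::'i). e)" if "0 < e" for e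
      unfolding lorentzian_def
    proof (intro exI[of _ "\<lambda>_. 1"] allI impI)
      fix x :: "'i \<Rightarrow> real" assume "(\<Sum>\<sigma>\<in>UNIV. 1 * x \<sigma>) = 0"
      then have "(\<Sum>\<tau>\<in>UNIV. x \<sigma> * e * x \<tau>) = 0" for \<sigma>
        by (simp only: mult_1 sum_distrib_left[symmetric] mult_zero_right)
      then show "qf (\<lambda>\<sigma> \<tau>. e) x x \<le> 0" by (simp only: qf_def) simp
    qed
    show "((\<lambda>e. e) \<longlongrightarrow> K \<sigma> \<tau>) (at_right 0)" for \<sigma> \<tau>
      using False by (auto intro: tendsto_eq_intros)
  qed auto
qed

text \<open>When the clique sum at \<open>q\<close> is positive, this places its
  \<open>Suc n\<close>-th root below the tangent hyperplane at \<open>q\<close>. It is the limit of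
  \<open>reverse_ineq_pos\<close> under simultaneous perturbation of \<open>K\<close> and
  \<open>q\<close>.\<close>

lemma reverse_ineq:
  fixes K :: "'i::finite \<Rightarrow> 'i \<Rightarrow> real"
  assumes sym: "\<And>\<sigma> \<tau>. K \<sigma> \<tau> = K \<tau> \<sigma>" and K: "\<And>\<sigma> \<tau>. 0 \<le> K \<sigma> \<tau>" and lor: "lorentzian K"
    and l: "\<And>\<sigma>. 0 \<le> l \<sigma>" and q: "\<And>\<sigma>. 0 \<le> q \<sigma>"
  shows "clique_sum K (Suc n) l * clique_sum K (Suc n) q ^ n
      \<le> (\<Sum>\<sigma>\<in>UNIV. l \<sigma> * clique_sum K n (\<lambda>\<tau>. q \<tau> * K \<sigma> \<tau>)) ^ Suc n"
proof -
  obtain P where P: "\<And>e \<sigma> \<tau>. P e \<sigma> \<tau> = P e \<tau> \<sigma>" "\<And>e \<sigma> \<tau>. 0 < e \<Longrightarrow> 0 < P e \<sigma> \<tau>"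
    "\<And>e. 0 < e \<Longrightarrow> lorentzian (P e)" and lim: "\<And>\<sigma> \<tau>. ((\<lambda>e. P e \<sigma> \<tau>) \<longlongrightarrow> K \<sigma> \<tau>) (at_right (0::real))"
    using lorentzian_perturbation[OF sym K lor] by metis
  have q_lim: "((\<lambda>e. q \<sigma> + e) \<longlongrightarrow> q \<sigma>) (at_right (0::real))" for \<sigma>
    by (auto intro!: tendsto_eq_intros)
  have "((\<lambda>e. clique_sum (P e) (Suc n) l * clique_sum (P e) (Suc n) (\<lambda>\<sigma>. q \<sigma> + e) ^ n)
      \<longlongrightarrow> clique_sum K (Suc n) l * clique_sum K (Suc n) q ^ n) (at_right 0)"
    by (intro tendsto_mult tendsto_power clique_sum_tendsto lim q_lim tendsto_const)
  moreover have "((\<lambda>e. (\<Sum>\<sigma>\<in>UNIV. l \<sigma> * clique_sum (P e) n (\<lambda>\<tau>. (q \<tau> + e) * P e \<sigma> \<tau>)) ^ Suc n)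
      \<longlongrightarrow> (\<Sum>\<sigma>\<in>UNIV. l \<sigma> * clique_sum K n (\<lambda>\<tau>. q \<tau> * K \<sigma> \<tau>)) ^ Suc n) (at_right 0)"
    by (intro tendsto_mult tendsto_power tendsto_sum clique_sum_tendsto lim q_lim tendsto_const)
  moreover have "eventually (\<lambda>e. clique_sum (P e) (Suc n) l * clique_sum (P e) (Suc n) (\<lambda>\<sigma>. q \<sigma> + e) ^ n
      \<le> (\<Sum>\<sigma>\<in>UNIV. l \<sigma> * clique_sum (P e) n (\<lambda>\<tau>. (q \<tau> + e) * P e \<sigma> \<tau>)) ^ Suc n) (at_right 0)"
    using eventually_at_right_less[of "0::real"]
  proof eventually_elim
    case (elim e)
    show ?case
      by (rule reverse_ineq_pos) (use P elim l q in \<open>auto intro: add_nonneg_pos\<close>)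
  qed
  ultimately show ?thesis by (intro tendsto_le[OF trivial_limit_at_right_real])
qed

section \<open>Supporting forms\<close>

text \<open>Hoelder's inequality without roots in the statement. Each \<open>g i\<close> is divided
  by its total; a vanishing total already forces \<open>f\<close> to vanish on
  \<open>A\<close>.\<close>

lemma finite_hoelder:
  fixes f :: "'a \<Rightarrow> real" and g :: "'b \<Rightarrow> 'a \<Rightarrow> real"
  assumes I: "finite I" "I \<noteq> {}" and f: "\<And>x. x \<in> A \<Longrightarrow> 0 \<le> f x"
    and g: "\<And>i x. i \<in> I \<Longrightarrow> x \<in> A \<Longrightarrow> 0 \<le> g i x"
    and le: "\<And>x. x \<in> A \<Longrightarrow> f x ^ card I \<le> (\<Prod>i\<in>I. g i x)"
  shows "(\<Sum>x\<in>A. f x) ^ card I \<le> (\<Prod>i\<in>I. \<Sum>x\<in>A. g i x)"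
proof (cases "finite A")
  case True
  define d where "d = card I"
  have d: "d > 0" using I by (simp add: d_def card_gt_0_iff)
  define s where "s i = (\<Sum>x\<in>A. g i x)" for i
  have s0: "0 \<le> s i" if "i \<in> I" for i unfolding s_def by (intro sum_nonneg g that)
  show ?thesis
  proof (cases "\<exists>i\<in>I. s i = 0")
    case True
    then obtain i where i: "i \<in> I" "s i = 0" by blast
    have "f x = 0" if "x \<in> A" for x
    proof -
      have "g i x = 0"
        using i \<open>finite A\<close> g that by (simp add: s_def sum_nonneg_eq_0_iff)
      then have "(\<Prod>i\<in>I. g i x) = 0" using I(1) i(1) by (metis prod_zero_iff)
      then have "f x ^ card I \<le> 0" using le[OF that] by simp
      then show ?thesis using f[OF that] d d_def
        by (metis order_antisym power_eq_0_iff zero_le_power)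
    qed
    then have "(\<Sum>x\<in>A. f x) = 0" by simp
    moreover have "0 \<le> (\<Prod>i\<in>I. s i)" by (intro prod_nonneg s0)
    ultimately show ?thesis using d by (simp add: d_def s_def power_0_left)
  next
    case False
    then have s: "0 < s i" if "i \<in> I" for i using s0[OF that] that by force
    define P where "P = root d (\<Prod>i\<in>I. s i)"
    have pp: "0 < (\<Prod>i\<in>I. s i)" by (intro prod_pos s)
    have P: "0 < P" "P ^ d = (\<Prod>i\<in>I. s i)"
      using d pp by (simp_all add: P_def)
    \<comment> \<open>Pointwise AM-GM for the normalised factors; since each of them has total 1,
      summing over \<open>A\<close> bounds the left side by 1.\<close>
    have "f x / P \<le> (\<Sum>i\<in>I. g i x / s i) / d" if x: "x \<in> A" for x
    proof -
      have "f x / P = root d ((f x / P) ^ d)"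
        using d P f[OF x] by (simp add: real_root_power_cancel)
      also have "\<dots> \<le> root d (\<Prod>i\<in>I. g i x / s i)"
      proof -
        have "f x ^ d / (\<Prod>i\<in>I. s i) \<le> (\<Prod>i\<in>I. g i x) / (\<Prod>i\<in>I. s i)"
          using le[OF x] pp by (simp add: d_def divide_right_mono)
        then show ?thesis using d by (simp add: power_divide P(2) prod_dividef)
      qed
      also have "\<dots> \<le> (\<Sum>i\<in>I. g i x / s i) / d"
      proof -
        have nn: "0 \<le> g i x / s i" if "i \<in> I" for i
          using g[OF that x] s[OF that] by simp
        then have "0 \<le> (\<Prod>i\<in>I. g i x / s i)" by (intro prod_nonneg)
        then have "root d (\<Prod>i\<in>I. g i x / s i) = (\<Prod>i\<in>I. g i x / s i) powr (1 / d)"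
          using d by (cases "(\<Prod>i\<in>I. g i x / s i) = 0") (auto simp: root_powr_inverse)
        also have "\<dots> \<le> (\<Sum>i\<in>I. g i x / s i / d)"
          unfolding d_def by (rule arith_geom_mean[OF I nn])
        finally show ?thesis by (simp only: sum_divide_distrib)
      qed
      finally show ?thesis .
    qed
    then have "(\<Sum>x\<in>A. f x / P) \<le> (\<Sum>x\<in>A. (\<Sum>i\<in>I. g i x / s i) / d)"
      by (rule sum_mono)
    also have "\<dots> = (\<Sum>i\<in>I. s i / s i) / d"
      by (simp only: sum_divide_distrib[symmetric] s_def sum.swap[of _ I A])
    also have "\<dots> = 1" using s d by (simp add: d_def less_imp_neq[THEN not_sym])
    finally have "(\<Sum>x\<in>A. f x) \<le> P" using P(1) by (simp add: sum_divide_distrib[symmetric])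
    then have "(\<Sum>x\<in>A. f x) ^ d \<le> P ^ d" by (intro power_mono sum_nonneg f)
    then show ?thesis unfolding P(2) unfolding d_def s_def .
  qed
qed (use I in \<open>simp add: card_gt_0_iff\<close>)

text \<open>One use of Hoelder per exposed vertex. The pointwise hypothesis passes to the links
  because \<open>K \<sigma> \<tau>\<close> occurs \<open>card I\<close> times on both sides.\<close>

lemma clique_sum_hoelder:
  fixes K :: "'i::finite \<Rightarrow> 'i \<Rightarrow> real"
  assumes K: "\<And>\<sigma> \<tau>. 0 \<le> K \<sigma> \<tau>" and I: "finite I" "I \<noteq> {}"
  shows "(\<And>\<sigma>. 0 \<le> l \<sigma>) \<Longrightarrow> (\<And>i \<sigma>. i \<in> I \<Longrightarrow> 0 \<le> m i \<sigma>) \<Longrightarrow>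
    (\<And>\<sigma>. l \<sigma> ^ card I \<le> (\<Prod>i\<in>I. m i \<sigma>)) \<Longrightarrow>
    clique_sum K n l ^ card I \<le> (\<Prod>i\<in>I. clique_sum K n (m i))"
proof (induction n arbitrary: l m)
  case 0
  then show ?case by simp
next
  case (Suc n)
  show ?case
    unfolding clique_sum.simps
  proof (rule finite_hoelder[OF I])
    fix \<sigma>
    have "(l \<tau> * K \<sigma> \<tau>) ^ card I \<le> (\<Prod>i\<in>I. m i \<tau> * K \<sigma> \<tau>)" for \<tau>
      using Suc.prems(3)[of \<tau>] K[of \<sigma> \<tau>]
      by (simp add: power_mult_distrib prod.distrib mult_right_mono)
    then have "clique_sum K n (\<lambda>\<tau>. l \<tau> * K \<sigma> \<tau>) ^ card I \<le> (\<Prod>i\<in>I. clique_sum K n (\<lambda>\<tau>. m i \<tau> * K \<sigma> \<tau>))"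
      by (intro Suc.IH mult_nonneg_nonneg Suc.prems K)
    then show "(l \<sigma> * clique_sum K n (\<lambda>\<tau>. l \<tau> * K \<sigma> \<tau>)) ^ card I
        \<le> (\<Prod>i\<in>I. m i \<sigma> * clique_sum K n (\<lambda>\<tau>. m i \<tau> * K \<sigma> \<tau>))"
      using Suc.prems unfolding power_mult_distrib prod.distrib
      by (intro mult_mono prod_nonneg zero_le_power clique_sum_nonneg K mult_nonneg_nonneg) auto
  qed (intro mult_nonneg_nonneg clique_sum_nonneg K Suc.prems; assumption)+
qed

definition supports :: "('i::finite \<Rightarrow> 'i \<Rightarrow> real) \<Rightarrow> nat \<Rightarrow> ('i \<Rightarrow> real) \<Rightarrow> bool" where
  "supports K n u \<longleftrightarrow> (\<forall>l. (\<forall>\<sigma>. 0 \<le> l \<sigma>) \<longrightarrow> clique_sum K n l \<le> (\<Sum>\<sigma>\<in>UNIV. l \<sigma> * u \<sigma>) ^ n)"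

lemma supportsD:
  "supports K n u \<Longrightarrow> (\<And>\<sigma>. 0 \<le> l \<sigma>) \<Longrightarrow> clique_sum K n l \<le> (\<Sum>\<sigma>\<in>UNIV. l \<sigma> * u \<sigma>) ^ n"
  by (simp add: supports_def)

lemma supports_mono:
  assumes "supports K n u" "\<And>\<sigma>. 0 \<le> u \<sigma>" "\<And>\<sigma>. u \<sigma> \<le> v \<sigma>"
  shows "supports K n v"
  unfolding supports_def
proof (intro allI impI)
  fix l :: "'a \<Rightarrow> real" assume l: "\<forall>\<sigma>. 0 \<le> l \<sigma>"
  have "clique_sum K n l \<le> (\<Sum>\<sigma>\<in>UNIV. l \<sigma> * u \<sigma>) ^ n"
    using assms(1) l by (simp add: supports_def)
  also have "\<dots> \<le> (\<Sum>\<sigma>\<in>UNIV. l \<sigma> * v \<sigma>) ^ n"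
    using l assms(2,3) by (intro power_mono sum_mono mult_left_mono sum_nonneg mult_nonneg_nonneg) auto
  finally show "clique_sum K n l \<le> (\<Sum>\<sigma>\<in>UNIV. l \<sigma> * v \<sigma>) ^ n" .
qed

text \<open>Lets positive shifts replace forms that vanish at some spins, by which one cannot
  divide.\<close>

lemma supports_limit:
  assumes "\<And>e. 0 < e \<Longrightarrow> supports K n (u e)"
    and lim: "\<And>\<sigma>. ((\<lambda>e. u e \<sigma>) \<longlongrightarrow> v \<sigma>) (at_right (0::real))"
  shows "supports K n v"
  unfolding supports_def
proof (intro allI impI)
  fix l :: "'a \<Rightarrow> real" assume l: "\<forall>\<sigma>. 0 \<le> l \<sigma>"
  have "((\<lambda>e. (\<Sum>\<sigma>\<in>UNIV. l \<sigma> * u e \<sigma>) ^ n) \<longlongrightarrow> (\<Sum>\<sigma>\<in>UNIV. l \<sigma> * v \<sigma>) ^ n) (at_right 0)"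
    by (intro tendsto_intros lim)
  moreover have "eventually (\<lambda>e. clique_sum K n l \<le> (\<Sum>\<sigma>\<in>UNIV. l \<sigma> * u e \<sigma>) ^ n) (at_right 0)"
    using eventually_at_right_less[of "0::real"]
    by eventually_elim (use assms(1) l in \<open>simp add: supports_def\<close>)
  ultimately show "clique_sum K n l \<le> (\<Sum>\<sigma>\<in>UNIV. l \<sigma> * v \<sigma>) ^ n"
    by (rule tendsto_lowerbound) simp
qed

text \<open>The product is the geometric mean of the forms \<open>y i ^ card I\<close>. Hoelder
  bounds the clique sum at \<open>l\<close> by those at \<open>card I\<close> rescaled vectors, one
  adapted to each form.\<close>

lemma supports_geometric_mean:
  assumes K: "\<And>\<sigma> \<tau>. 0 \<le> K \<sigma> \<tau>" and I: "finite I" "I \<noteq> {}"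
    and y: "\<And>i \<sigma>. i \<in> I \<Longrightarrow> 0 \<le> y i \<sigma>"
    and sup: "\<And>i. i \<in> I \<Longrightarrow> supports K n (\<lambda>\<sigma>. y i \<sigma> ^ card I)"
  shows "supports K n (\<lambda>\<sigma>. \<Prod>i\<in>I. y i \<sigma>)"
proof (rule supports_limit)
  show "((\<lambda>e. \<Prod>i\<in>I. y i \<sigma> + e) \<longlongrightarrow> (\<Prod>i\<in>I. y i \<sigma>)) (at_right 0)" for \<sigma>
    by (rule tendsto_eq_intros refl | simp)+
  define d where "d = card I"
  have d: "d > 0" using I by (simp add: d_def card_gt_0_iff)
  fix e :: real assume e: "0 < e"
  define z where "z i \<sigma> = y i \<sigma> + e" for i \<sigma>
  have z: "0 < z i \<sigma>" if "i \<in> I" for i \<sigma> using y[OF that, of \<sigma>] e by (simp add: z_def)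
  have supz: "supports K n (\<lambda>\<sigma>. z i \<sigma> ^ d)" if "i \<in> I" for i
    by (rule supports_mono[OF sup[OF that]]) (use that y e in \<open>auto simp: z_def d_def intro!: power_mono\<close>)
  have "supports K n (\<lambda>\<sigma>. \<Prod>i\<in>I. z i \<sigma>)"
    unfolding supports_def
  proof (intro allI impI)
    fix l :: "'a \<Rightarrow> real" assume l: "\<forall>\<sigma>. 0 \<le> l \<sigma>"
    \<comment> \<open>Chosen so that \<open>l\<close> is the geometric mean of the vectors
      \<open>p / z i ^ d\<close>, each of which pairs with its form \<open>z i ^ d\<close> to the
      same total, the sum of \<open>p\<close>.\<close>
    define p where "p \<sigma> = l \<sigma> * (\<Prod>i\<in>I. z i \<sigma>)" for \<sigma>
    have p: "0 \<le> p \<sigma>" for \<sigma>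
      unfolding p_def using l by (intro mult_nonneg_nonneg prod_nonneg less_imp_le[OF z]) auto
    have "clique_sum K n l ^ d \<le> (\<Prod>i\<in>I. clique_sum K n (\<lambda>\<sigma>. p \<sigma> / z i \<sigma> ^ d))"
      unfolding d_def
    proof (rule clique_sum_hoelder[OF K I])
      show "l \<sigma> ^ card I \<le> (\<Prod>i\<in>I. p \<sigma> / z i \<sigma> ^ card I)" for \<sigma>
      proof -
        have "0 < (\<Prod>i\<in>I. z i \<sigma>)" by (intro prod_pos z)
        moreover have "(\<Prod>i\<in>I. p \<sigma> / z i \<sigma> ^ card I) = p \<sigma> ^ card I / (\<Prod>i\<in>I. z i \<sigma>) ^ card I"
          by (simp add: prod_dividef prod_power_distrib)
        ultimately show ?thesis by (simp add: p_def power_mult_distrib)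
      qed
    qed (use l p z in \<open>auto simp: less_imp_le\<close>)
    also have "\<dots> \<le> (\<Prod>i\<in>I. (\<Sum>\<sigma>\<in>UNIV. p \<sigma>) ^ n)"
    proof (rule prod_mono)
      fix i assume i: "i \<in> I"
      have "clique_sum K n (\<lambda>\<sigma>. p \<sigma> / z i \<sigma> ^ d) \<le> (\<Sum>\<sigma>\<in>UNIV. p \<sigma> / z i \<sigma> ^ d * z i \<sigma> ^ d) ^ n"
        by (rule supportsD[OF supz[OF i]]) (use p z[OF i] in \<open>simp add: less_imp_le\<close>)
      also have "(\<Sum>\<sigma>\<in>UNIV. p \<sigma> / z i \<sigma> ^ d * z i \<sigma> ^ d) = (\<Sum>\<sigma>\<in>UNIV. p \<sigma>)"
        using z[OF i] by (simp add: less_imp_neq[THEN not_sym])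
      finally show "0 \<le> clique_sum K n (\<lambda>\<sigma>. p \<sigma> / z i \<sigma> ^ d) \<and>
          clique_sum K n (\<lambda>\<sigma>. p \<sigma> / z i \<sigma> ^ d) \<le> (\<Sum>\<sigma>\<in>UNIV. p \<sigma>) ^ n"
        using p z[OF i] by (auto intro!: clique_sum_nonneg K simp: less_imp_le)
    qed
    also have "\<dots> = ((\<Sum>\<sigma>\<in>UNIV. p \<sigma>) ^ n) ^ d"
      by (simp add: d_def)
    finally have "clique_sum K n l ^ d \<le> ((\<Sum>\<sigma>\<in>UNIV. p \<sigma>) ^ n) ^ d" .
    then have "clique_sum K n l \<le> (\<Sum>\<sigma>\<in>UNIV. p \<sigma>) ^ n"
      using d p by (simp add: power_mono_iff clique_sum_nonneg K l sum_nonneg)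
    then show "clique_sum K n l \<le> (\<Sum>\<sigma>\<in>UNIV. l \<sigma> * (\<Prod>i\<in>I. z i \<sigma>)) ^ n"
      by (simp add: p_def)
  qed
  then show "supports K n (\<lambda>\<sigma>. \<Prod>i\<in>I. y i \<sigma> + e)" by (simp only: z_def)
qed

text \<open>The tangent form of \<open>reverse_ineq\<close>, normalised:
  \<open>(c ^ n) ^ Suc n\<close> is the \<open>n\<close>-th power of the clique sum at
  \<open>q\<close>.\<close>

lemma supports_gradient:
  fixes K :: "'i::finite \<Rightarrow> 'i \<Rightarrow> real"
  assumes sym: "\<And>\<sigma> \<tau>. K \<sigma> \<tau> = K \<tau> \<sigma>" and K: "\<And>\<sigma> \<tau>. 0 \<le> K \<sigma> \<tau>" and lor: "lorentzian K"
    and q: "\<And>\<sigma>. 0 \<le> q \<sigma>" and c: "0 < c" "c ^ Suc n = clique_sum K (Suc n) q"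
  shows "supports K (Suc n) (\<lambda>\<sigma>. clique_sum K n (\<lambda>\<tau>. q \<tau> * K \<sigma> \<tau>) / c ^ n)"
  unfolding supports_def
proof (intro allI impI)
  fix l :: "'i \<Rightarrow> real" assume l: "\<forall>\<sigma>. 0 \<le> l \<sigma>"
  define Q where "Q \<sigma> = clique_sum K n (\<lambda>\<tau>. q \<tau> * K \<sigma> \<tau>)" for \<sigma>
  have "clique_sum K (Suc n) l * (c ^ n) ^ Suc n = clique_sum K (Suc n) l * (c ^ Suc n) ^ n"
    by (simp only: power_mult[symmetric] mult.commute)
  also have "\<dots> \<le> (\<Sum>\<sigma>\<in>UNIV. l \<sigma> * Q \<sigma>) ^ Suc n"
    unfolding c(2) Q_def by (intro reverse_ineq sym K lor q) (use l in auto)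
  finally have "clique_sum K (Suc n) l \<le> (\<Sum>\<sigma>\<in>UNIV. l \<sigma> * Q \<sigma>) ^ Suc n / (c ^ n) ^ Suc n"
    using c(1) by (simp add: pos_le_divide_eq del: power_Suc clique_sum.simps)
  also have "\<dots> = (\<Sum>\<sigma>\<in>UNIV. l \<sigma> * (Q \<sigma> / c ^ n)) ^ Suc n"
    by (simp only: power_divide[symmetric] sum_divide_distrib times_divide_eq_right)
  finally show "clique_sum K (Suc n) l \<le> (\<Sum>\<sigma>\<in>UNIV. l \<sigma> * (clique_sum K n (\<lambda>\<tau>. q \<tau> * K \<sigma> \<tau>) / c ^ n)) ^ Suc n"
    by (simp only: Q_def)
qed

text \<open>Let \<open>p\<close> be a maximiser of order \<open>m + 3\<close> and \<open>p0\<close> a maximiser of order \<open>m + 2\<close> on the face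
  spanned by the support of \<open>p\<close>. In the link of a spin \<open>\<tau>\<close> charged by \<open>p0\<close>, the gradient at \<open>p0\<close>
  is a supporting form of order \<open>m + 1\<close>; the induction hypothesis raises it to order \<open>m + 2\<close>. Its
  geometric mean with \<open>y\<close>, evaluated at the link of \<open>\<tau>\<close> in \<open>p\<close> and averaged over \<open>\<tau>\<close> with weights
  \<open>p0\<close>, compares the two maxima.\<close>

lemma supports_Suc_pos:
  fixes K :: "'i::finite \<Rightarrow> 'i \<Rightarrow> real"
  assumes sym: "\<And>\<sigma> \<tau>. K \<sigma> \<tau> = K \<tau> \<sigma>" and K: "\<And>\<sigma> \<tau>. 0 \<le> K \<sigma> \<tau>" and lor: "lorentzian K"
    and IH: "\<And>z. 0 < m \<Longrightarrow> (\<And>\<sigma>. 0 \<le> z \<sigma>) \<Longrightarrow> supports K (Suc m) (\<lambda>\<sigma>. z \<sigma> ^ m) \<Longrightarrow>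
      supports K (Suc (Suc m)) (\<lambda>\<sigma>. z \<sigma> ^ Suc m)"
    and y: "\<And>\<sigma>. 0 < y \<sigma>" and sup: "supports K (Suc (Suc m)) (\<lambda>\<sigma>. y \<sigma> ^ Suc m)"
  shows "supports K (Suc (Suc (Suc m))) (\<lambda>\<sigma>. y \<sigma> ^ Suc (Suc m))"
proof -
  obtain p where mx: "maximiser_on (\<lambda>\<sigma>. y \<sigma> ^ Suc (Suc m)) UNIV K (Suc (Suc (Suc m))) p"
    by (rule maximiser_on_exists[OF zero_less_power[OF y] UNIV_not_empty])
  note p = maximiser_onD(1,3)[OF mx] and maxp = maximiser_onD(4)[OF mx]
  define M where "M = clique_sum K (Suc (Suc (Suc m))) p"
  have "0 \<le> M" unfolding M_def by (intro clique_sum_nonneg K p)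
  have gradp: "clique_sum K (Suc (Suc m)) (\<lambda>\<tau>. p \<tau> * K \<sigma> \<tau>) = M * y \<sigma> ^ Suc (Suc m)" if "0 < p \<sigma>" for \<sigma>
    unfolding M_def
    by (rule maximiser_on_gradient(2)[OF sym K mx that])
  \<comment> \<open>Confining \<open>p0\<close> to the support of \<open>p\<close> makes
    \<open>gradp\<close> available at every spin that \<open>p0\<close> charges.\<close>
  define S where "S = {\<sigma>. 0 < p \<sigma>}"
  have "S \<noteq> {}"
  proof
    assume "S = {}"
    then have "p \<sigma> = 0" for \<sigma> using p(1)[of \<sigma>] by (auto simp: S_def order_le_less)
    then show False using p(2) by simp
  qed
  obtain p0 where mx0: "maximiser_on (\<lambda>\<sigma>. y \<sigma> ^ Suc m) S K (Suc (Suc m)) p0"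
    by (rule maximiser_on_exists[OF zero_less_power[OF y] \<open>S \<noteq> {}\<close>])
  note p0 = maximiser_onD(1-3)[OF mx0] and max0 = maximiser_onD(4)[OF mx0]
  define \<Lambda> where "\<Lambda> = clique_sum K (Suc (Suc m)) p0"
  have "0 \<le> \<Lambda>" unfolding \<Lambda>_def by (intro clique_sum_nonneg K p0)
  have "\<Lambda> \<le> 1"
    using supportsD[OF sup, where l = p0, OF p0(1)] by (simp only: p0(3) \<Lambda>_def power_one)
  have grad_le: "clique_sum K (Suc m) (\<lambda>\<tau>. p0 \<tau> * K \<sigma> \<tau>) \<le> \<Lambda> * y \<sigma> ^ Suc m" if "\<sigma> \<in> S" for \<sigma>
    unfolding \<Lambda>_def
    by (rule maximiser_on_gradient(1)[OF sym K mx0 that])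
  have grad0: "clique_sum K (Suc m) (\<lambda>\<tau>. p0 \<tau> * K \<sigma> \<tau>) = \<Lambda> * y \<sigma> ^ Suc m" if "0 < p0 \<sigma>" for \<sigma>
    unfolding \<Lambda>_def
    by (rule maximiser_on_gradient(2)[OF sym K mx0 that])
  have "M \<le> 1"
  proof (cases "\<Lambda> = 0")
    case True
    \<comment> \<open>All clique sums of order \<open>m + 2\<close> on the face vanish, in
      particular those of the links in \<open>p\<close>.\<close>
    have "clique_sum K (Suc (Suc m)) (\<lambda>\<tau>. p \<tau> * K \<sigma> \<tau>) \<le> 0" for \<sigma>
    proof -
      have "p \<tau> = 0" if "\<tau> \<notin> S" for \<tau> using that p(1)[of \<tau>] by (simp add: S_def)
      then have "clique_sum K (Suc (Suc m)) (\<lambda>\<tau>. p \<tau> * K \<sigma> \<tau>)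
        \<le> \<Lambda> * (\<Sum>\<tau>\<in>UNIV. p \<tau> * K \<sigma> \<tau> * y \<tau> ^ Suc m) ^ Suc (Suc m)"
        unfolding \<Lambda>_def by (intro max0 mult_nonneg_nonneg p K) auto
      then show ?thesis by (simp add: True del: clique_sum.simps)
    qed
    then have "M \<le> 0"
      unfolding M_def clique_sum.simps(2)[of K "Suc (Suc m)"]
      by (intro sum_nonpos mult_nonneg_nonpos p)
    then show ?thesis by simp
  next
    case False
    then have "0 < \<Lambda>" using \<open>0 \<le> \<Lambda>\<close> by simp
    \<comment> \<open>Again each root has order one less than the clique sum whose maximum it is
      taken of.\<close>
    define r where "r = root (Suc (Suc m)) M"
    define s where "s = root (Suc m) \<Lambda>"
    have r: "0 \<le> r" "r ^ Suc (Suc m) = M"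
      unfolding r_def using \<open>0 \<le> M\<close> by (simp_all del: power_Suc)
    have s: "0 < s" "s ^ Suc m = \<Lambda>"
      unfolding s_def using \<open>0 < \<Lambda>\<close> by (simp_all del: power_Suc)
    define Q where "Q \<sigma> \<tau> = clique_sum K m (\<lambda>\<rho>. p0 \<rho> * K \<sigma> \<rho> * K \<tau> \<rho>)" for \<sigma> \<tau>
    have Q0: "0 \<le> Q \<sigma> \<tau>" for \<sigma> \<tau>
      unfolding Q_def by (intro clique_sum_nonneg mult_nonneg_nonneg K p0)
    have supQ: "supports K (Suc (Suc m)) (\<lambda>\<sigma>. Q \<tau> \<sigma> / (s * y \<tau>) ^ m * y \<sigma>)" if \<tau>: "0 < p0 \<tau>" for \<tau>
    proof (cases "m = 0")
      case True
      then show ?thesis using sup by (simp add: Q_def)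
    next
      case False
      \<comment> \<open>By \<open>grad0\<close>, \<open>c ^ Suc m\<close> is the clique sum of the
        link of \<open>\<tau>\<close> in \<open>p0\<close>, as \<open>supports_gradient\<close>
        demands.\<close>
      define c where "c = s * y \<tau>"
      have c: "0 < c" unfolding c_def using s y[of \<tau>] by simp
      have cB: "c ^ Suc m = clique_sum K (Suc m) (\<lambda>\<rho>. p0 \<rho> * K \<tau> \<rho>)"
        unfolding grad0[OF \<tau>] c_def power_mult_distrib s(2) ..
      define z where "z \<sigma> = root m (Q \<tau> \<sigma>) / c" for \<sigma>
      have z0: "0 \<le> z \<sigma>" for \<sigma> using Q0 c by (simp add: z_def real_root_ge_zero)
      have zm: "z \<sigma> ^ m = Q \<tau> \<sigma> / c ^ m" for \<sigma>
        using Q0 False by (simp add: z_def power_divide)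
      have "supports K (Suc m) (\<lambda>\<sigma>. z \<sigma> ^ m)"
        unfolding zm Q_def by (rule supports_gradient[OF sym K lor _ c cB]) (intro mult_nonneg_nonneg p0 K)
      then have supz: "supports K (Suc (Suc m)) (\<lambda>\<sigma>. z \<sigma> ^ Suc m)"
        using IH False z0 by simp
      \<comment> \<open>A geometric mean of \<open>m + 1\<close> forms: \<open>m\<close> copies of
        the one from \<open>z\<close> and a single one from \<open>y\<close>.\<close>
      have "supports K (Suc (Suc m)) (\<lambda>\<sigma>. \<Prod>i\<in>{..m}. if i < m then z \<sigma> else y \<sigma>)"
      proof (rule supports_geometric_mean[OF K])
        fix i assume "i \<in> {..m}"
        show "supports K (Suc (Suc m)) (\<lambda>\<sigma>. (if i < m then z \<sigma> else y \<sigma>) ^ card {..m})"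
          using supz sup by (cases "i < m") (simp_all del: power_Suc)
      qed (use z0 y in \<open>auto simp: less_imp_le\<close>)
      moreover have "(\<Prod>i\<in>{..m}. if i < m then z \<sigma> else y \<sigma>) = z \<sigma> ^ m * y \<sigma>" for \<sigma>
        by (simp add: lessThan_Suc_atMost[symmetric])
      ultimately show ?thesis by (simp add: zm c_def)
    qed
    \<comment> \<open>The form of \<open>supQ\<close> evaluated at the link of \<open>\<tau>\<close>
      in \<open>p\<close>, whose clique sum is \<open>(r * y \<tau>) ^ Suc (Suc m)\<close> by
      \<open>gradp\<close>.\<close>
    have link: "p0 \<tau> * (r * s ^ m * y \<tau> ^ Suc m) \<le> p0 \<tau> * (\<Sum>\<sigma>\<in>UNIV. p \<sigma> * y \<sigma> * K \<tau> \<sigma> * Q \<tau> \<sigma>)" for \<tau>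
    proof (cases "p0 \<tau> = 0")
      case False
      then have \<tau>: "0 < p0 \<tau>" using p0(1)[of \<tau>] by simp
      then have "\<tau> \<in> S" using p0(2)[of \<tau>] by fastforce
      then have pt: "0 < p \<tau>" by (simp add: S_def)
      define c where "c = s * y \<tau>"
      have c: "0 < c" unfolding c_def using s y[of \<tau>] by simp
      have "(r * y \<tau>) ^ Suc (Suc m) = clique_sum K (Suc (Suc m)) (\<lambda>\<sigma>. p \<sigma> * K \<tau> \<sigma>)"
        unfolding gradp[OF pt] power_mult_distrib r(2) ..
      also have "\<dots> \<le> (\<Sum>\<sigma>\<in>UNIV. p \<sigma> * K \<tau> \<sigma> * (Q \<tau> \<sigma> / c ^ m * y \<sigma>)) ^ Suc (Suc m)"
        unfolding c_def by (intro supportsD[OF supQ[OF \<tau>]] mult_nonneg_nonneg p K)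
      finally have "r * y \<tau> \<le> (\<Sum>\<sigma>\<in>UNIV. p \<sigma> * K \<tau> \<sigma> * (Q \<tau> \<sigma> / c ^ m * y \<sigma>))"
        by (rule power_le_imp_le_base)
          (use c in \<open>auto intro!: sum_nonneg mult_nonneg_nonneg divide_nonneg_pos p K Q0 less_imp_le[OF y]\<close>)
      also have "\<dots> = (\<Sum>\<sigma>\<in>UNIV. p \<sigma> * y \<sigma> * K \<tau> \<sigma> * Q \<tau> \<sigma>) / c ^ m"
        by (simp add: sum_divide_distrib mult_ac)
      finally have "r * y \<tau> * c ^ m \<le> (\<Sum>\<sigma>\<in>UNIV. p \<sigma> * y \<sigma> * K \<tau> \<sigma> * Q \<tau> \<sigma>)"
        using c by (simp add: pos_le_divide_eq)
      moreover have "r * y \<tau> * c ^ m = r * s ^ m * y \<tau> ^ Suc m"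
        by (simp add: c_def power_mult_distrib)
      ultimately show ?thesis using \<tau> by simp
    qed simp
    have "r * s ^ m = (\<Sum>\<tau>\<in>UNIV. p0 \<tau> * (r * s ^ m * y \<tau> ^ Suc m))"
    proof -
      have "(\<Sum>\<tau>\<in>UNIV. p0 \<tau> * (r * s ^ m * y \<tau> ^ Suc m)) = r * s ^ m * (\<Sum>\<tau>\<in>UNIV. p0 \<tau> * y \<tau> ^ Suc m)"
        unfolding sum_distrib_left by (intro sum.cong refl) (simp only: mult_ac)
      then show ?thesis by (simp only: p0(3) mult_1_right)
    qed
    also have "\<dots> \<le> (\<Sum>\<tau>\<in>UNIV. p0 \<tau> * (\<Sum>\<sigma>\<in>UNIV. p \<sigma> * y \<sigma> * K \<tau> \<sigma> * Q \<tau> \<sigma>))"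
      by (intro sum_mono link)
    \<comment> \<open>Summing over \<open>\<tau>\<close> first reassembles the link sum of
      \<open>p0\<close> at \<open>\<sigma>\<close>.\<close>
    also have "\<dots> = (\<Sum>\<sigma>\<in>UNIV. p \<sigma> * y \<sigma> * clique_sum K (Suc m) (\<lambda>\<tau>. p0 \<tau> * K \<sigma> \<tau>))"
    proof -
      have eq: "p0 \<tau> * (p \<sigma> * y \<sigma> * K \<tau> \<sigma> * Q \<tau> \<sigma>) = p \<sigma> * y \<sigma> * (p0 \<tau> * K \<sigma> \<tau> * clique_sum K m (\<lambda>\<rho>. p0 \<rho> * K \<sigma> \<rho> * K \<tau> \<rho>))" for \<sigma> \<tau>
        unfolding Q_def sym[of \<tau> \<sigma>] by (simp only: mult_ac)
      show ?thesis
        unfolding clique_sum.simps sum_distrib_left by (subst sum.swap) (intro sum.cong refl eq)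
    qed
    \<comment> \<open>The support of \<open>p\<close> may exceed that of \<open>p0\<close>, so the
      inequality on the whole face is used, not the equality \<open>grad0\<close>.\<close>
    also have "\<dots> \<le> (\<Sum>\<sigma>\<in>UNIV. p \<sigma> * y \<sigma> * (\<Lambda> * y \<sigma> ^ Suc m))"
    proof (rule sum_mono)
      fix \<sigma>
      show "p \<sigma> * y \<sigma> * clique_sum K (Suc m) (\<lambda>\<tau>. p0 \<tau> * K \<sigma> \<tau>) \<le> p \<sigma> * y \<sigma> * (\<Lambda> * y \<sigma> ^ Suc m)"
      proof (cases "\<sigma> \<in> S")
        case True
        then show ?thesis
          by (intro mult_left_mono grad_le mult_nonneg_nonneg p less_imp_le[OF y])
      next
        case False
        then have "p \<sigma> = 0" using p(1)[of \<sigma>] by (simp add: S_def)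
        then show ?thesis by simp
      qed
    qed
    also have "\<dots> = \<Lambda> * (\<Sum>\<sigma>\<in>UNIV. p \<sigma> * y \<sigma> ^ Suc (Suc m))"
      by (simp add: sum_distrib_left mult_ac)
    \<comment> \<open>The chain now reads \<open>r * s ^ m \<le> s * s ^ m\<close>, comparing the
      two maxima.\<close>
    also have "\<dots> = s * s ^ m" unfolding p(2) by (simp add: s(2)[symmetric])
    finally have "r \<le> s" using s(1) by simp
    also have "s \<le> 1" unfolding s_def using \<open>\<Lambda> \<le> 1\<close> by simp
    finally show "M \<le> 1" unfolding r(2)[symmetric] using r(1) by (intro power_le_one)
  qed
  show ?thesis
    unfolding supports_def
  proof (intro allI impI)
    fix l :: "'i \<Rightarrow> real" assume l: "\<forall>\<sigma>. 0 \<le> l \<sigma>"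
    have "clique_sum K (Suc (Suc (Suc m))) l \<le> M * (\<Sum>\<sigma>\<in>UNIV. l \<sigma> * y \<sigma> ^ Suc (Suc m)) ^ Suc (Suc (Suc m))"
      unfolding M_def by (rule maxp) (use l in auto)
    also have "\<dots> \<le> 1 * (\<Sum>\<sigma>\<in>UNIV. l \<sigma> * y \<sigma> ^ Suc (Suc m)) ^ Suc (Suc (Suc m))"
      using l \<open>M \<le> 1\<close> by (intro mult_right_mono zero_le_power sum_nonneg mult_nonneg_nonneg less_imp_le[OF y]) auto
    finally show "clique_sum K (Suc (Suc (Suc m))) l \<le> (\<Sum>\<sigma>\<in>UNIV. l \<sigma> * y \<sigma> ^ Suc (Suc m)) ^ Suc (Suc (Suc m))"
      by simp
  qed
qed

text \<open>\<open>supports_Suc_pos\<close> freed from positivity by shifting \<open>y\<close>; its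
  induction hypothesis is vacuous for \<open>m = 0\<close>, which starts the induction.\<close>

lemma supports_Suc:
  fixes K :: "'i::finite \<Rightarrow> 'i \<Rightarrow> real"
  assumes sym: "\<And>\<sigma> \<tau>. K \<sigma> \<tau> = K \<tau> \<sigma>" and K: "\<And>\<sigma> \<tau>. 0 \<le> K \<sigma> \<tau>" and lor: "lorentzian K"
  shows "(\<And>\<sigma>. 0 \<le> y \<sigma>) \<Longrightarrow> supports K (Suc (Suc m)) (\<lambda>\<sigma>. y \<sigma> ^ Suc m) \<Longrightarrow>
    supports K (Suc (Suc (Suc m))) (\<lambda>\<sigma>. y \<sigma> ^ Suc (Suc m))"
proof (induction m arbitrary: y)
  case (0 y)
  show ?case
  proof (rule supports_limit)
    show "supports K (Suc (Suc (Suc 0))) (\<lambda>\<sigma>. (y \<sigma> + e) ^ Suc (Suc 0))" if "0 < e" for e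
    proof (rule supports_Suc_pos[OF sym K lor])
      show "supports K (Suc (Suc 0)) (\<lambda>\<sigma>. (y \<sigma> + e) ^ Suc 0)"
        by (rule supports_mono[OF 0(2)]) (use 0(1) that in auto)
    qed (use 0(1) that in \<open>auto intro: add_nonneg_pos\<close>)
    show "((\<lambda>e. (y \<sigma> + e) ^ Suc (Suc 0)) \<longlongrightarrow> y \<sigma> ^ Suc (Suc 0)) (at_right 0)" for \<sigma>
      by (rule tendsto_eq_intros refl | simp)+
  qed
next
  case (Suc m y)
  show ?case
  proof (rule supports_limit)
    show "supports K (Suc (Suc (Suc (Suc m)))) (\<lambda>\<sigma>. (y \<sigma> + e) ^ Suc (Suc (Suc m)))" if "0 < e" for e
    proof (rule supports_Suc_pos[OF sym K lor Suc.IH])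
      show "supports K (Suc (Suc (Suc m))) (\<lambda>\<sigma>. (y \<sigma> + e) ^ Suc (Suc m))"
        by (rule supports_mono[OF Suc.prems(2)]) (use Suc.prems(1) that in \<open>auto intro!: power_mono simp del: power_Suc\<close>)
    qed (use Suc.prems(1) that in \<open>auto intro: add_nonneg_pos\<close>)
    show "((\<lambda>e. (y \<sigma> + e) ^ Suc (Suc (Suc m))) \<longlongrightarrow> y \<sigma> ^ Suc (Suc (Suc m))) (at_right 0)" for \<sigma>
      by (rule tendsto_eq_intros refl | simp)+
  qed
qed

lemma supports_le:
  fixes K :: "'i::finite \<Rightarrow> 'i \<Rightarrow> real"
  assumes sym: "\<And>\<sigma> \<tau>. K \<sigma> \<tau> = K \<tau> \<sigma>" and K: "\<And>\<sigma> \<tau>. 0 \<le> K \<sigma> \<tau>" and lor: "lorentzian K"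
    and y: "\<And>\<sigma>. 0 \<le> y \<sigma>" and "0 < k" "k \<le> d" and sup: "supports K (Suc k) (\<lambda>\<sigma>. y \<sigma> ^ k)"
  shows "supports K (Suc d) (\<lambda>\<sigma>. y \<sigma> ^ d)"
  using \<open>k \<le> d\<close>
proof (induction d rule: dec_induct)
  case (step n)
  then obtain m where "n = Suc m" using \<open>0 < k\<close> by (cases n) auto
  then show ?case using supports_Suc[OF sym K lor y, of m] step.IH by simp
qed (rule sup)

text \<open>The local inequality at the deleted vertex: \<open>l\<close> is its fugacity,
  \<open>N\<close> its neighbourhood, and \<open>b w\<close>, \<open>k w\<close> are fugacity and
  degree of a neighbour. The bound on \<open>k w\<close> lets all factors be raised to the common
  order \<open>card N + 1\<close>.\<close>

lemma neighbourhood_ineq: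
  fixes K :: "'i::finite \<Rightarrow> 'i \<Rightarrow> real" and N :: "'v set"
  assumes sym: "\<And>\<sigma> \<tau>. K \<sigma> \<tau> = K \<tau> \<sigma>" and K: "\<And>\<sigma> \<tau>. 0 \<le> K \<sigma> \<tau>" and lor: "lorentzian K"
    and N: "finite N" and k: "\<And>w. w \<in> N \<Longrightarrow> 0 < k w \<and> k w \<le> card N"
    and l: "\<And>\<sigma>. 0 \<le> l \<sigma>" and b: "\<And>w \<sigma>. w \<in> N \<Longrightarrow> 0 \<le> b w \<sigma>"
  shows "clique_sum K (card N + 1) l powr (1 / real (card N + 1)) *
      (\<Prod>w\<in>N. clique_sum K (k w + 1) (b w) powr (1 / real (k w + 1)))
    \<le> (\<Sum>\<sigma>\<in>UNIV. l \<sigma> * (\<Prod>w\<in>N. clique_sum K (k w) (\<lambda>\<tau>. b w \<tau> * K \<sigma> \<tau>) powr (1 / real (k w))))"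
    (is "?P * (\<Prod>w\<in>N. ?c w) \<le> (\<Sum>\<sigma>\<in>UNIV. l \<sigma> * (\<Prod>w\<in>N. ?a w \<sigma>))")
proof -
  have rhs0: "0 \<le> (\<Sum>\<sigma>\<in>UNIV. l \<sigma> * (\<Prod>w\<in>N. ?a w \<sigma>))"
    by (intro sum_nonneg mult_nonneg_nonneg l prod_nonneg) simp
  consider "N = {}" | w where "w \<in> N" "clique_sum K (k w + 1) (b w) = 0"
    | "N \<noteq> {}" "\<And>w. w \<in> N \<Longrightarrow> clique_sum K (k w + 1) (b w) \<noteq> 0" by blast
  then show ?thesis
  proof cases
    case 1
    then show ?thesis using l by (simp add: sum_nonneg)
  next
    case 2
    then have "?c w = 0" by simp
    then have "(\<Prod>w\<in>N. ?c w) = 0" using 2(1) N by (meson prod_zero_iff)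
    then show ?thesis using rhs0 by (simp only: mult_zero_right)
  next
    case 3
    \<comment> \<open>The normalised factor of \<open>w\<close>: its \<open>k w\<close>-th power is
      the supporting form that \<open>supports_gradient\<close> yields at
      \<open>b w\<close>.\<close>
    define y where "y w \<sigma> = ?a w \<sigma> / ?c w" for w \<sigma>
    have c: "0 < ?c w" "?c w ^ Suc (k w) = clique_sum K (Suc (k w)) (b w)" if "w \<in> N" for w
    proof -
      have pos: "0 < clique_sum K (k w + 1) (b w)"
        using 3(2)[OF that] clique_sum_nonneg[where K = K and a = "b w" and n = "k w + 1", OF K b[OF that]]
        by linarith
      then show "0 < ?c w" by simp
      show "?c w ^ Suc (k w) = clique_sum K (Suc (k w)) (b w)"
        using pos by (simp add: powr_realpow[symmetric] powr_powr del: power_Suc clique_sum.simps)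
    qed
    have y0: "0 \<le> y w \<sigma>" for w \<sigma> by (simp add: y_def)
    have "supports K (Suc (card N)) (\<lambda>\<sigma>. \<Prod>w\<in>N. y w \<sigma>)"
    proof (rule supports_geometric_mean[OF K N 3(1) y0])
      fix w assume w: "w \<in> N"
      have "y w \<sigma> ^ k w = clique_sum K (k w) (\<lambda>\<tau>. b w \<tau> * K \<sigma> \<tau>) / ?c w ^ k w" for \<sigma>
      proof -
        have "?a w \<sigma> ^ k w = clique_sum K (k w) (\<lambda>\<tau>. b w \<tau> * K \<sigma> \<tau>)"
        proof (cases "clique_sum K (k w) (\<lambda>\<tau>. b w \<tau> * K \<sigma> \<tau>) = 0")
          case True
          then show ?thesis using k[OF w] by (simp add: power_0_left)
        next
          case False
          have "0 \<le> clique_sum K (k w) (\<lambda>\<tau>. b w \<tau> * K \<sigma> \<tau>)"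
            by (intro clique_sum_nonneg mult_nonneg_nonneg K b[OF w])
          then show ?thesis using False k[OF w]
            by (simp add: powr_realpow[symmetric] powr_powr)
        qed
        then show ?thesis by (simp add: y_def power_divide)
      qed
      then have "supports K (Suc (k w)) (\<lambda>\<sigma>. y w \<sigma> ^ k w)"
        using supports_gradient[OF sym K lor b[OF w] c[OF w]] by simp
      then show "supports K (Suc (card N)) (\<lambda>\<sigma>. y w \<sigma> ^ card N)"
        by (rule supports_le[OF sym K lor y0 conjunct1[OF k[OF w]] conjunct2[OF k[OF w]]])
    qed
    then have le: "clique_sum K (Suc (card N)) l \<le> (\<Sum>\<sigma>\<in>UNIV. l \<sigma> * (\<Prod>w\<in>N. y w \<sigma>)) ^ Suc (card N)"
      by (rule supportsD[OF _ l])
    have s0: "0 \<le> (\<Sum>\<sigma>\<in>UNIV. l \<sigma> * (\<Prod>w\<in>N. y w \<sigma>))"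
      by (intro sum_nonneg mult_nonneg_nonneg l prod_nonneg y0)
    have "?P \<le> ((\<Sum>\<sigma>\<in>UNIV. l \<sigma> * (\<Prod>w\<in>N. y w \<sigma>)) ^ Suc (card N)) powr (1 / real (card N + 1))"
      using le clique_sum_nonneg[where K = K and a = l and n = "card N + 1", OF K l]
      by (intro powr_mono2) (simp_all del: power_Suc clique_sum.simps)
    also have "\<dots> = (\<Sum>\<sigma>\<in>UNIV. l \<sigma> * (\<Prod>w\<in>N. y w \<sigma>))"
    proof (cases "(\<Sum>\<sigma>\<in>UNIV. l \<sigma> * (\<Prod>w\<in>N. y w \<sigma>)) = 0")
      case False
      then have "0 < (\<Sum>\<sigma>\<in>UNIV. l \<sigma> * (\<Prod>w\<in>N. y w \<sigma>))" using s0 by linarith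
      then show ?thesis by (simp add: powr_realpow[symmetric] powr_powr del: power_Suc)
    qed simp
    also have "\<dots> = (\<Sum>\<sigma>\<in>UNIV. l \<sigma> * (\<Prod>w\<in>N. ?a w \<sigma>)) / (\<Prod>w\<in>N. ?c w)"
      by (simp add: y_def prod_dividef sum_divide_distrib)
    finally have "?P \<le> (\<Sum>\<sigma>\<in>UNIV. l \<sigma> * (\<Prod>w\<in>N. ?a w \<sigma>)) / (\<Prod>w\<in>N. ?c w)" .
    moreover have "0 < (\<Prod>w\<in>N. ?c w)" by (intro prod_pos c)
    ultimately show ?thesis by (simp only: pos_le_divide_eq)
  qed
qed

section \<open>Deleting a vertex of maximal degree\<close>

lemma simple_graph_remove:
  assumes "simple_graph V E"
  shows "simple_graph (V - {u}) {e \<in> E. u \<notin> e}"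
  using assms by (auto simp: simple_graph_def)

lemma simple_graph_finite: "simple_graph V E \<Longrightarrow> finite E"
  by (rule finite_subset[of E "Pow V"]) (auto simp: simple_graph_def)

lemma simple_graph_edge:
  assumes "simple_graph V E" "{u, w} \<in> E"
  shows "u \<noteq> w" "u \<in> V" "w \<in> V"
proof -
  have "{u, w} \<subseteq> V" "card {u, w} = 2" using assms by (auto simp: simple_graph_def)
  then show "u \<noteq> w" "u \<in> V" "w \<in> V" by auto
qed

lemma edges_through:
  assumes G: "simple_graph V E"
  shows "{e \<in> E. u \<in> e} = (\<lambda>w. {u, w}) ` {w. {u, w} \<in> E}"
proof
  show "{e \<in> E. u \<in> e} \<subseteq> (\<lambda>w. {u, w}) ` {w. {u, w} \<in> E}"
  proof
    fix e assume e: "e \<in> {e \<in> E. u \<in> e}"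
    then have "card e = 2" using G by (simp add: simple_graph_def)
    then obtain a b where "e = {a, b}" by (meson card_2_iff)
    then obtain w where "e = {u, w}" using e by (cases "u = a") auto
    then show "e \<in> (\<lambda>w. {u, w}) ` {w. {u, w} \<in> E}" using e by auto
  qed
qed auto

lemma inj_on_edge: "inj_on (\<lambda>w. {u, w}) A"
  by (auto simp: inj_on_def doubleton_eq_iff)

lemma graph_degree_neighbours:
  assumes "simple_graph V E"
  shows "graph_degree E u = card {w. {u, w} \<in> E}"
  unfolding graph_degree_def edges_through[OF assms] by (rule card_image[OF inj_on_edge])

lemma graph_degree_remove:
  assumes G: "simple_graph V E" and "w \<noteq> u"
  shows "graph_degree E w = graph_degree {e \<in> E. u \<notin> e} w + (if {u, w} \<in> E then 1 else 0)"
proof -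
  define X where "X = {x. {w, x} \<in> E}"
  have "finite X"
    by (rule finite_subset[of _ V]) (use G simple_graph_edge[OF G] in \<open>auto simp: simple_graph_def X_def\<close>)
  have deg: "graph_degree E w = card X"
    unfolding X_def by (rule graph_degree_neighbours[OF G])
  have "{x. {w, x} \<in> {e \<in> E. u \<notin> e}} = X - {u}"
    using \<open>w \<noteq> u\<close> by (auto simp: X_def)
  then have deg': "graph_degree {e \<in> E. u \<notin> e} w = card (X - {u})"
    by (simp only: graph_degree_neighbours[OF simple_graph_remove[OF G]])
  have uX: "u \<in> X \<longleftrightarrow> {u, w} \<in> E" by (simp add: X_def insert_commute)
  show ?thesis
  proof (cases "u \<in> X")
    case True
    then show ?thesis using card_Suc_Diff1[OF \<open>finite X\<close> True] uX by (simp add: deg deg')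
  next
    case False
    then show ?thesis using uX by (simp add: deg deg')
  qed
qed

lemma edge_weight_cong:
  assumes "transpose H = H" "card e = 2" "\<And>v. v \<in> e \<Longrightarrow> s v = t v"
  shows "edge_weight H s e = edge_weight H t e"
proof -
  obtain a b where "e = {a, b}" using assms(2) by (meson card_2_iff)
  then show ?thesis using assms(1,3) by (simp add: edge_weight_pair)
qed

text \<open>Conditioning on the spin of \<open>u\<close> absorbs its edges into the fugacities of
  its neighbours. This is why the induction runs over vertex-dependent fugacities.\<close>

lemma Z_inhom_remove:
  fixes H :: "real^'i^'i" and L :: "'v \<Rightarrow> real^'i"
  assumes sym: "transpose H = H" and G: "simple_graph V E" and u: "u \<in> V"
  shows "Z_inhom H V E L = (\<Sum>\<sigma>\<in>UNIV. L u $ \<sigma> * Z_inhom H (V - {u}) {e \<in> E. u \<notin> e}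
    (\<lambda>w. if {u, w} \<in> E then \<chi> \<tau>. L w $ \<tau> * H $ \<sigma> $ \<tau> else L w))"
proof -
  define V' where "V' = V - {u}"
  define E' where "E' = {e \<in> E. u \<notin> e}"
  define N where "N = {w. {u, w} \<in> E}"
  define L' where "L' \<sigma> = (\<lambda>w. if {u, w} \<in> E then \<chi> \<tau>. L w $ \<tau> * H $ \<sigma> $ \<tau> else L w)" for \<sigma>
  define F where "F s = (\<Prod>e\<in>E. edge_weight H s e) * (\<Prod>v\<in>V. L v $ s v)" for s
  define F' where "F' \<sigma> s = (\<Prod>e\<in>E'. edge_weight H s e) * (\<Prod>v\<in>V'. L' \<sigma> v $ s v)" for \<sigma> s
  have V: "V = insert u V'" "u \<notin> V'" using u by (auto simp: V'_def)
  have fin: "finite V'" "finite E" "finite E'"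
    using G simple_graph_finite[OF G] by (auto simp: V'_def E'_def simple_graph_def)
  have N: "N \<subseteq> V'" using simple_graph_edge[OF G] by (auto simp: N_def V'_def)
  have key: "F (g(u := \<sigma>)) = L u $ \<sigma> * F' \<sigma> g" for g \<sigma>
  proof -
    have "E = E' \<union> {e \<in> E. u \<in> e}" by (auto simp: E'_def)
    then have "(\<Prod>e\<in>E. edge_weight H (g(u := \<sigma>)) e)
        = (\<Prod>e\<in>E'. edge_weight H (g(u := \<sigma>)) e) * (\<Prod>e\<in>{e \<in> E. u \<in> e}. edge_weight H (g(u := \<sigma>)) e)"
      using fin by (metis (no_types, lifting) E'_def prod.union_disjoint disjoint_iff finite_Un mem_Collect_eq)
    also have "(\<Prod>e\<in>E'. edge_weight H (g(u := \<sigma>)) e) = (\<Prod>e\<in>E'. edge_weight H g e)"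
      by (intro prod.cong refl edge_weight_cong sym) (use G in \<open>auto simp: E'_def simple_graph_def\<close>)
    also have "(\<Prod>e\<in>{e \<in> E. u \<in> e}. edge_weight H (g(u := \<sigma>)) e) = (\<Prod>w\<in>N. H $ \<sigma> $ g w)"
      unfolding edges_through[OF G] N_def[symmetric] prod.reindex[OF inj_on_edge]
      by (intro prod.cong refl) (use N V in \<open>auto simp: edge_weight_pair[OF sym]\<close>)
    \<comment> \<open>Padding with ones gives a product over \<open>V'\<close>, which merges with
      the fugacity product.\<close>
    also have "(\<Prod>w\<in>N. H $ \<sigma> $ g w) = (\<Prod>w\<in>V'. if w \<in> N then H $ \<sigma> $ g w else 1)"
      using N fin(1) by (simp add: prod.If_cases Int_absorb1)
    finally have E: "(\<Prod>e\<in>E. edge_weight H (g(u := \<sigma>)) e)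
      = (\<Prod>e\<in>E'. edge_weight H g e) * (\<Prod>w\<in>V'. if w \<in> N then H $ \<sigma> $ g w else 1)" .
    have "(\<Prod>v\<in>V. L v $ (g(u := \<sigma>)) v) = L u $ \<sigma> * (\<Prod>v\<in>V'. L v $ (g(u := \<sigma>)) v)"
      using V fin(1) by simp
    also have "(\<Prod>v\<in>V'. L v $ (g(u := \<sigma>)) v) = (\<Prod>v\<in>V'. L v $ g v)"
      using V(2) by (intro prod.cong) auto
    finally have "F (g(u := \<sigma>)) = L u $ \<sigma> * ((\<Prod>e\<in>E'. edge_weight H g e) *
      (\<Prod>w\<in>V'. (if w \<in> N then H $ \<sigma> $ g w else 1) * (L w $ g w)))"
      unfolding F_def E by (simp add: prod.distrib)
    also have "(\<Prod>w\<in>V'. (if w \<in> N then H $ \<sigma> $ g w else 1) * (L w $ g w)) = (\<Prod>v\<in>V'. L' \<sigma> v $ g v)"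
      by (intro prod.cong) (auto simp: L'_def N_def)
    finally show ?thesis by (simp only: F'_def)
  qed
  \<comment> \<open>Each spin assignment on \<open>V\<close> arises exactly once as
    \<open>g(u := \<sigma>)\<close> with \<open>g\<close> on \<open>V'\<close>.\<close>
  have "Z_inhom H V E L = sum F ((\<lambda>(\<sigma>, g). g(u := \<sigma>)) ` (UNIV \<times> (V' \<rightarrow>\<^sub>E UNIV)))"
    unfolding Z_inhom_def F_def V(1) PiE_insert_eq by (simp add: V(1))
  also have "\<dots> = (\<Sum>(\<sigma>, g)\<in>UNIV \<times> (V' \<rightarrow>\<^sub>E UNIV). F (g(u := \<sigma>)))"
    by (subst sum.reindex[OF inj_combinator[OF V(2)]]) (simp add: case_prod_unfold)
  also have "\<dots> = (\<Sum>\<sigma>\<in>UNIV. L u $ \<sigma> * (\<Sum>g\<in>V' \<rightarrow>\<^sub>E UNIV. F' \<sigma> g))"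
    by (simp add: sum.cartesian_product[symmetric] key sum_distrib_left)
  finally show ?thesis by (simp only: F'_def L'_def V'_def E'_def Z_inhom_def)
qed

section \<open>Complete graphs: \<open>Z_complete\<close> as a clique sum\<close>

lemma Z_inhom_cong:
  assumes "\<And>v. v \<in> V \<Longrightarrow> L v = L' v"
  shows "Z_inhom H V E L = Z_inhom H V E L'"
  using assms by (simp add: Z_inhom_def cong: prod.cong)

text \<open>In a complete graph every other vertex is adjacent to the deleted one, so equal
  fugacities stay equal and vertex deletion becomes the recursion of
  \<open>clique_sum\<close>.\<close>

lemma Z_inhom_complete:
  fixes H :: "real^'i^'i" and V :: "'v set"
  assumes sym: "transpose H = H" and "finite V"
  shows "Z_inhom H V (complete_edges V) (\<lambda>_. a) = clique_sum (\<lambda>\<sigma> \<tau>. H $ \<sigma> $ \<tau>) (card V) (($) a)"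
  using \<open>finite V\<close>
proof (induction V arbitrary: a rule: finite_induct)
  case empty
  have "complete_edges ({} :: 'v set) = {}" by (auto simp: complete_edges_def)
  then show ?case by (simp add: Z_inhom_def)
next
  case (insert u V)
  have G: "simple_graph (insert u V) (complete_edges (insert u V))"
    using insert.hyps(1) by (auto simp: simple_graph_def complete_edges_def)
  have V: "insert u V - {u} = V" using insert.hyps(2) by auto
  have E: "{e \<in> complete_edges (insert u V). u \<notin> e} = complete_edges V"
    using insert.hyps(2) by (auto simp: complete_edges_def)
  have adj: "{u, w} \<in> complete_edges (insert u V)" if "w \<in> V" for w
  proof -
    have "u \<noteq> w" using that insert.hyps(2) by blast
    then show ?thesis using that by (simp add: complete_edges_def)
  qed
  have step: "Z_inhom H V (complete_edges V)
      (\<lambda>w. if {u, w} \<in> complete_edges (insert u V) then \<chi> \<tau>. a $ \<tau> * H $ \<sigma> $ \<tau> else a)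
    = clique_sum (\<lambda>\<sigma> \<tau>. H $ \<sigma> $ \<tau>) (card V) (\<lambda>\<tau>. a $ \<tau> * H $ \<sigma> $ \<tau>)" for \<sigma>
  proof -
    have "Z_inhom H V (complete_edges V)
        (\<lambda>w. if {u, w} \<in> complete_edges (insert u V) then \<chi> \<tau>. a $ \<tau> * H $ \<sigma> $ \<tau> else a)
      = Z_inhom H V (complete_edges V) (\<lambda>_. \<chi> \<tau>. a $ \<tau> * H $ \<sigma> $ \<tau>)"
      by (rule Z_inhom_cong) (simp add: adj)
    then show ?thesis using insert.IH[of "\<chi> \<tau>. a $ \<tau> * H $ \<sigma> $ \<tau>"] by (simp add: vec_lambda_inverse)
  qed
  show ?case
    unfolding Z_inhom_remove[OF sym G insertI1] V E step using insert.hyps by simp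
qed

lemma Z_complete_eq_clique_sum:
  assumes "transpose H = H"
  shows "Z_complete H m l = clique_sum (\<lambda>\<sigma> \<tau>. H $ \<sigma> $ \<tau>) m (($) l)"
  unfolding Z_complete_def Z_def Z_inhom_complete[OF assms finite_lessThan] by simp

text \<open>Induction on the number of vertices. Factors of non-neighbours of the deleted vertex are
  untouched and form \<open>R\<close>; the others are handled by
  \<open>neighbourhood_ineq\<close>.\<close>

lemma Z_inhom_lower_bound:
  fixes H :: "real^'i^'i" and V :: "'v set" and L :: "'v \<Rightarrow> real^'i"
  defines "K \<equiv> \<lambda>\<sigma> \<tau>. H $ \<sigma> $ \<tau>"
  assumes H: "antiferromagnetic H"
  shows "simple_graph V E \<Longrightarrow> (\<And>v \<sigma>. v \<in> V \<Longrightarrow> 0 \<le> L v $ \<sigma>) \<Longrightarrow>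
    (\<Prod>v\<in>V. clique_sum K (graph_degree E v + 1) (($) (L v)) powr (1 / real (graph_degree E v + 1)))
      \<le> Z_inhom H V E L"
proof (induction "card V" arbitrary: V E L rule: less_induct)
  case (less V E L)
  note G = less.prems(1) and L = less.prems(2)
  have tr: "transpose H = H" and K: "0 \<le> K \<sigma> \<tau>" for \<sigma> \<tau>
    using H by (auto simp: antiferromagnetic_def model_def K_def)
  have sym: "K \<sigma> \<tau> = K \<tau> \<sigma>" for \<sigma> \<tau>
    unfolding K_def by (metis tr transpose_def vec_lambda_beta)
  have lor: "lorentzian K" unfolding K_def by (rule antiferromagnetic_lorentzian[OF H])
  have finV: "finite V" using G by (simp add: simple_graph_def)
  define P where "P w = clique_sum K (graph_degree E w + 1) (($) (L w)) powr (1 / real (graph_degree E w + 1))" for w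
  show ?case
  proof (cases "V = {}")
    case True
    then have "E = {}" using G by (auto simp: simple_graph_def)
    then show ?thesis using True by (simp add: Z_inhom_def)
  next
    case False
    \<comment> \<open>Maximality is needed because supporting forms can only be raised to higher order.\<close>
    obtain u where u: "u \<in> V" and max: "\<And>w. w \<in> V \<Longrightarrow> graph_degree E w \<le> graph_degree E u"
    proof -
      have "Max (graph_degree E ` V) \<in> graph_degree E ` V" using finV False by simp
      then obtain u where "u \<in> V" "graph_degree E u = Max (graph_degree E ` V)" by auto
      then show thesis using that finV by (metis Max_ge finite_imageI imageI)
    qed
    define N where "N = {w. {u, w} \<in> E}"
    define V' where "V' = V - {u}"
    define E' where "E' = {e \<in> E. u \<notin> e}"
    define L' where "L' \<sigma> = (\<lambda>w. if {u, w} \<in> E then \<chi> \<tau>. L w $ \<tau> * H $ \<sigma> $ \<tau> else L w)" for \<sigma>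
    have V: "V = insert u V'" "u \<notin> V'" and finV': "finite V'" using u finV by (auto simp: V'_def)
    have N: "N \<subseteq> V'" using simple_graph_edge[OF G] by (auto simp: N_def V'_def)
    have finN: "finite N" using N finV' by (rule finite_subset)
    have cardN: "graph_degree E u = card N" unfolding N_def by (rule graph_degree_neighbours[OF G])
    have degN: "graph_degree E w = graph_degree E' w + 1" if "w \<in> N" for w
      using graph_degree_remove[OF G, of w u] that N V(2) by (auto simp: E'_def N_def)
    have degO: "graph_degree E w = graph_degree E' w" if "w \<in> V' - N" for w
      using graph_degree_remove[OF G, of w u] that V(2) by (auto simp: E'_def N_def)
    have G': "simple_graph V' E'" unfolding V'_def E'_def by (rule simple_graph_remove[OF G])
    define R where "R = (\<Prod>w\<in>V' - N. P w)"
    have R0: "0 \<le> R" unfolding R_def P_def by (intro prod_nonneg) simp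
    define A where "A \<sigma> = (\<Prod>w\<in>N. clique_sum K (graph_degree E w) (\<lambda>\<tau>. L w $ \<tau> * K \<sigma> \<tau>) powr (1 / real (graph_degree E w)))" for \<sigma>
    \<comment> \<open>A neighbour loses one degree, so its clique sum has order
      \<open>graph_degree E w\<close> after deletion, now at the fugacity twisted by
      \<open>K \<sigma>\<close>.\<close>
    have IH: "A \<sigma> * R \<le> Z_inhom H V' E' (L' \<sigma>)" for \<sigma>
    proof -
      have "(\<Prod>w\<in>V'. clique_sum K (graph_degree E' w + 1) (($) (L' \<sigma> w)) powr (1 / real (graph_degree E' w + 1)))
        = (\<Prod>w\<in>V' - N. clique_sum K (graph_degree E' w + 1) (($) (L' \<sigma> w)) powr (1 / real (graph_degree E' w + 1)))
         * (\<Prod>w\<in>N. clique_sum K (graph_degree E' w + 1) (($) (L' \<sigma> w)) powr (1 / real (graph_degree E' w + 1)))"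
        by (rule prod.subset_diff[OF N finV'])
      also have "(\<Prod>w\<in>V' - N. clique_sum K (graph_degree E' w + 1) (($) (L' \<sigma> w)) powr (1 / real (graph_degree E' w + 1))) = R"
        unfolding R_def
      proof (rule prod.cong[OF refl])
        fix w assume w: "w \<in> V' - N"
        then have "L' \<sigma> w = L w" by (simp add: L'_def N_def)
        then show "clique_sum K (graph_degree E' w + 1) (($) (L' \<sigma> w)) powr (1 / real (graph_degree E' w + 1)) = P w"
          by (simp only: P_def degO[OF w])
      qed
      also have "(\<Prod>w\<in>N. clique_sum K (graph_degree E' w + 1) (($) (L' \<sigma> w)) powr (1 / real (graph_degree E' w + 1))) = A \<sigma>"
        unfolding A_def
      proof (rule prod.cong[OF refl])
        fix w assume w: "w \<in> N"
        then have "($) (L' \<sigma> w) = (\<lambda>\<tau>. L w $ \<tau> * K \<sigma> \<tau>)" by (simp add: L'_def N_def K_def fun_eq_iff)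
        then show "clique_sum K (graph_degree E' w + 1) (($) (L' \<sigma> w)) powr (1 / real (graph_degree E' w + 1))
          = clique_sum K (graph_degree E w) (\<lambda>\<tau>. L w $ \<tau> * K \<sigma> \<tau>) powr (1 / real (graph_degree E w))"
          by (simp only: degN[OF w])
      qed
      finally have "(\<Prod>w\<in>V'. clique_sum K (graph_degree E' w + 1) (($) (L' \<sigma> w)) powr (1 / real (graph_degree E' w + 1))) = R * A \<sigma>" .
      moreover have "(\<Prod>w\<in>V'. clique_sum K (graph_degree E' w + 1) (($) (L' \<sigma> w)) powr (1 / real (graph_degree E' w + 1)))
          \<le> Z_inhom H V' E' (L' \<sigma>)"
      proof (rule less.hyps[OF _ G'])
        show "card V' < card V" using V finV' by simp
        show "0 \<le> L' \<sigma> v $ \<tau>" if "v \<in> V'" for v \<tau>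
          using L[of v \<tau>] K[of \<sigma> \<tau>] that by (simp add: L'_def V'_def K_def)
      qed
      ultimately show ?thesis by (simp add: mult.commute)
    qed
    \<comment> \<open>Neighbours have positive degree because of the edge to \<open>u\<close>, and
      degree at most \<open>card N\<close> by the choice of \<open>u\<close>.\<close>
    have vertex: "P u * (\<Prod>w\<in>N. P w) \<le> (\<Sum>\<sigma>\<in>UNIV. L u $ \<sigma> * A \<sigma>)"
      unfolding P_def A_def cardN
    proof (rule neighbourhood_ineq[OF sym K lor finN])
      show "0 < graph_degree E w \<and> graph_degree E w \<le> card N" if "w \<in> N" for w
        using degN[OF that] max[of w] that N by (auto simp: cardN V'_def)
    qed (use L u N in \<open>auto simp: V'_def\<close>)
    have "(\<Prod>w\<in>V. P w) = P u * ((\<Prod>w\<in>V' - N. P w) * (\<Prod>w\<in>N. P w))"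
      using V finV' by (simp add: prod.subset_diff[OF N finV'])
    also have "\<dots> = (P u * (\<Prod>w\<in>N. P w)) * R" by (simp add: R_def mult_ac)
    also have "\<dots> \<le> (\<Sum>\<sigma>\<in>UNIV. L u $ \<sigma> * A \<sigma>) * R"
      by (rule mult_right_mono[OF vertex R0])
    also have "\<dots> = (\<Sum>\<sigma>\<in>UNIV. L u $ \<sigma> * (A \<sigma> * R))" by (simp add: sum_distrib_right mult.assoc)
    also have "\<dots> \<le> (\<Sum>\<sigma>\<in>UNIV. L u $ \<sigma> * Z_inhom H V' E' (L' \<sigma>))"
      by (intro sum_mono mult_left_mono IH L u)
    also have "\<dots> = Z_inhom H V E L"
      by (simp only: Z_inhom_remove[OF tr G u, of L] V'_def E'_def L'_def)
    finally show ?thesis by (simp only: P_def)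
  qed
qed

theorem theorem1p2:
  fixes H :: "real^'i^'i" and V :: "'v set" and E :: "'v set set"
    and L :: "'v \<Rightarrow> real^'i"
  assumes "antiferromagnetic H"
    and "simple_graph V E"
    and "\<And>v \<sigma>. v \<in> V \<Longrightarrow> 0 \<le> L v $ \<sigma>"
  shows "Z_inhom H V E L \<ge>
    (\<Prod>v\<in>V. Z_complete H (graph_degree E v + 1) (L v) powr (1 / real (graph_degree E v + 1)))"
proof -
  have "transpose H = H" using assms(1) by (simp add: antiferromagnetic_def model_def)
  then show ?thesis
    using Z_inhom_lower_bound[OF assms] by (simp only: Z_complete_eq_clique_sum)
qed

end
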